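(* Fix real numbers $\alpha,\beta\ge 0$. Suppose that $V_\alpha\ge\beta\,\mathrm{FB}$ holds for every finite bilateral-trade instance with independent types. Then $V_\alpha\ge\beta\,\mathrm{FB}$ holds for every finite matching market with independent types and downward-closed feasibility.
   Context: A finite matching market consists of finite disjoint sets $B$ (buyers) and $S$ (sellers), a set $E\subseteq B\times S$ of compatible edges, and a nonempty family $\mathcal F$ of matchings of the bipartite graph $(B,S,E)$ that is downward-closed (if $M\in\mathcal F$ and $M'\subseteq M$ then $M'\in\mathcal F$). Buyer $i$ has a private real value $v_i$ with finite support, all support points having positive probability; seller $j$ has a private real cost $c_j$ with finite support likewise. All types are mutually independent with publicly known distributions. Bilateral trade is the case of one buyer, one seller, one edge $e$ and $\mathcal F=\{\emptyset,\{e\}\}$. A (direct) mechanism assigns to every profile of reports (each report in the agent's support) a probability distribution over $\mathcal F$, with edge probabilities $x_{ij}$, and a real payment $p_a$ (of either sign) from each agent $a$ to the mechanism. With $q_i=\sum_j x_{ij}$ and $y_j=\sum_i x_{ij}$, buyer $i$'s utility is $v_iq_i-p_i$ and seller $j$'s utility is $-c_jy_j-p_j$. BIC: for each agent and each type, truthful reporting maximizes the expected utility when all other agents report truthfully. IIR: each type's expected truthful utility is nonnegative. Under truthful reporting, $\mathrm{GFT}=\mathbb E[\sum_{(i,j)\in E}(v_i-c_j)x_{ij}]$ and $\mathrm{Rev}=\mathbb E[\sum_a p_a]$. First best is $\mathrm{FB}=\mathbb E[\max_{M\in\mathcal F}\sum_{(i,j)\in M}(v_i-c_j)]$. For $\alpha\ge0$,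 $V_\alpha=\sup\{\mathrm{GFT}(\mathcal M)+\alpha\,\mathrm{Rev}(\mathcal M)\}$ over all BIC and IIR mechanisms $\mathcal M$ (no budget constraint is imposed). *)

theory Defs
  imports "HOL-Probability.Probability"
begin

text \<open>
  Buyers and sellers live in one agent type. The private type of a buyer is her value and that of
  a seller is his cost; a \<^typ>\<open>real pmf\<close> gives positive probability to every point of its support,
  \<^term>\<open>set_pmf\<close>, which is also the set of admissible reports.
\<close>

record 'a market =
  buyers :: "'a set"
  sellers :: "'a set"
  edges :: "('a \<times> 'a) set"
  feasible :: "('a \<times> 'a) set set"
  type_dist :: "'a \<Rightarrow> real pmf"

definition agents :: "'a market \<Rightarrow> 'a set" where
  "agents I = buyers I \<union> sellers I"

definition matching :: "('a \<times> 'a) set \<Rightarrow> ('a \<times> 'a) set \<Rightarrow> bool" where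
  "matching E M \<longleftrightarrow> M \<subseteq> E \<and>
     (\<forall>i j i' j'. (i, j) \<in> M \<and> (i', j') \<in> M \<and> (i = i' \<or> j = j') \<longrightarrow> (i, j) = (i', j'))"

definition matching_market :: "'a market \<Rightarrow> bool" where
  "matching_market I \<longleftrightarrow>
     finite (buyers I) \<and> finite (sellers I) \<and> buyers I \<inter> sellers I = {} \<and>
     edges I \<subseteq> buyers I \<times> sellers I \<and>
     feasible I \<noteq> {} \<and> (\<forall>M\<in>feasible I. matching (edges I) M) \<and>
     (\<forall>M\<in>feasible I. \<forall>M'. M' \<subseteq> M \<longrightarrow> M' \<in> feasible I) \<and>
     (\<forall>a\<in>agents I. finite (set_pmf (type_dist I a)))"

definition bilateral_trade :: "'a market \<Rightarrow> bool" where
  "bilateral_trade I \<longleftrightarrow> matching_market I \<and>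
     (\<exists>b s. buyers I = {b} \<and> sellers I = {s} \<and> edges I = {(b, s)} \<and>
            feasible I = {{}, {(b, s)}})"

text \<open>
  A type profile is a function on the whole agent type, set to the dummy value 0 outside the
  agents. Independence is built in by taking the product distribution \<^term>\<open>Pi_pmf\<close>.
\<close>

definition profiles :: "'a market \<Rightarrow> ('a \<Rightarrow> real) set" where
  "profiles I = PiE_dflt (agents I) 0 (\<lambda>a. set_pmf (type_dist I a))"

definition prior :: "'a market \<Rightarrow> ('a \<Rightarrow> real) pmf" where
  "prior I = Pi_pmf (agents I) 0 (type_dist I)"

definition prior_others :: "'a market \<Rightarrow> 'a \<Rightarrow> ('a \<Rightarrow> real) pmf" where
  "prior_others I a = Pi_pmf (agents I - {a}) 0 (type_dist I)"

text \<open>Payments go from the agent to the mechanism and may have either sign.\<close>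

record 'a mechanism =
  alloc :: "('a \<Rightarrow> real) \<Rightarrow> ('a \<times> 'a) set pmf"
  payment :: "('a \<Rightarrow> real) \<Rightarrow> 'a \<Rightarrow> real"

definition is_mechanism :: "'a market \<Rightarrow> 'a mechanism \<Rightarrow> bool" where
  "is_mechanism I M \<longleftrightarrow> (\<forall>\<theta>\<in>profiles I. set_pmf (alloc M \<theta>) \<subseteq> feasible I)"

definition edge_prob :: "'a mechanism \<Rightarrow> ('a \<Rightarrow> real) \<Rightarrow> 'a \<Rightarrow> 'a \<Rightarrow> real" where
  "edge_prob M \<theta> i j = measure_pmf.prob (alloc M \<theta>) {m. (i, j) \<in> m}"

text \<open>Utility of agent \<open>a\<close> with true type \<open>t\<close> when the profile of reports is \<open>\<theta>\<close>.\<close>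

definition utility :: "'a market \<Rightarrow> 'a mechanism \<Rightarrow> 'a \<Rightarrow> real \<Rightarrow> ('a \<Rightarrow> real) \<Rightarrow> real" where
  "utility I M a t \<theta> =
     (if a \<in> buyers I then t * (\<Sum>j\<in>sellers I. edge_prob M \<theta> a j) - payment M \<theta> a
      else - t * (\<Sum>i\<in>buyers I. edge_prob M \<theta> i a) - payment M \<theta> a)"

text \<open>Expected utility of agent \<open>a\<close> with true type \<open>t\<close> and report \<open>r\<close>, the others being truthful.\<close>

definition interim_utility :: "'a market \<Rightarrow> 'a mechanism \<Rightarrow> 'a \<Rightarrow> real \<Rightarrow> real \<Rightarrow> real" where
  "interim_utility I M a t r =
     measure_pmf.expectation (prior_others I a) (\<lambda>\<theta>. utility I M a t (\<theta>(a := r)))"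

definition BIC :: "'a market \<Rightarrow> 'a mechanism \<Rightarrow> bool" where
  "BIC I M \<longleftrightarrow> (\<forall>a\<in>agents I. \<forall>t\<in>set_pmf (type_dist I a). \<forall>r\<in>set_pmf (type_dist I a).
     interim_utility I M a t t \<ge> interim_utility I M a t r)"

definition IIR :: "'a market \<Rightarrow> 'a mechanism \<Rightarrow> bool" where
  "IIR I M \<longleftrightarrow> (\<forall>a\<in>agents I. \<forall>t\<in>set_pmf (type_dist I a). interim_utility I M a t t \<ge> 0)"

definition GFT :: "'a market \<Rightarrow> 'a mechanism \<Rightarrow> real" where
  "GFT I M = measure_pmf.expectation (prior I)
     (\<lambda>\<theta>. \<Sum>(i, j)\<in>edges I. (\<theta> i - \<theta> j) * edge_prob M \<theta> i j)"

definition Rev :: "'a market \<Rightarrow> 'a mechanism \<Rightarrow> real" where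
  "Rev I M = measure_pmf.expectation (prior I) (\<lambda>\<theta>. \<Sum>a\<in>agents I. payment M \<theta> a)"

definition FB :: "'a market \<Rightarrow> real" where
  "FB I = measure_pmf.expectation (prior I)
     (\<lambda>\<theta>. Max ((\<lambda>m. \<Sum>(i, j)\<in>m. \<theta> i - \<theta> j) ` feasible I))"

text \<open>The supremum is taken in \<^typ>\<open>ereal\<close>, so that no boundedness has to be presupposed.\<close>

definition V :: "real \<Rightarrow> 'a market \<Rightarrow> ereal" where
  "V \<alpha> I = (SUP M\<in>{M. is_mechanism I M \<and> BIC I M \<and> IIR I M}. ereal (GFT I M + \<alpha> * Rev I M))"

end

theory Submission
  imports Defs
begin

text \<open>
  Count a seller of cost \<open>c\<close> as an agent of value \<open>-c\<close>. Myerson's analysis bounds \<open>V\<^sub>\<alpha>\<close> of a market from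
  below by the expected maximum, over feasible matchings, of the sum of ironed values (ironing
  \<open>z + \<alpha> \<phi>(z)\<close>, with \<open>\<phi>\<close> the virtual value). Restrict to the edges of the first-best
  matching whose ironed values \<open>v'\<close>, \<open>b'\<close> have a nonnegative sum. Fixing all other types, the pairs \<open>(v, b)\<close>
  for which a given edge is in the first best form an upper set \<open>R\<close> on which \<open>v + b \<ge> 0\<close>, so
  it suffices to show \<open>E[max 0 (v' + b'); R] \<ge> \<beta> E[v + b; R]\<close>. For rectangles \<open>R\<close> this is the
  bilateral hypothesis. For a general \<open>R\<close>, choose for each buyer value the least quantity, bought
  from the best sellers, that meets the bound pointwise in \<open>v\<close>. By linear programming duality
  the choice can only exceed the capacity of \<open>R\<close> at \<open>v\<close> if some buyer distribution, against the
  seller restricted to the section of \<open>R\<close> at \<open>v\<close>, violates the bilateral hypothesis.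
\<close>

section \<open>Ironing\<close>

text \<open>The obstacle is that ironed values belong to a distribution, while the bilateral
  hypothesis must be applied to other distributions. For the seller this is harmless: only upper
  sets of values are conditioned on, and the tail sums behind ironing do not see lower values. For
  the buyer it is not: duality produces buyer distributions unrelated to the given one. So the buyer
  stays un-ironed, as thresholds \<open>d\<close> with payment \<open>price\<close> and rent
  \<open>rent\<close>, and the bound is demanded separately at each buyer value. Such a bound can be
  averaged against any distribution; only the average against the true one is ironed. Buyer values
  interact through the rent: what a low value buys adds to the rent of every higher value, hence the
  choice of the least quantity. Rectangles suffice as test instances because the sections of R grow
  with v: below a buyer value b all of R lies over the section at b, and the first best of that
  rectangle dominates the target. Finally, without a budget constraint the objective is a sum of
  interim terms of single agents, which is what allows ironing agent by agent.\<close>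

definition tail :: "real set \<Rightarrow> real \<Rightarrow> real set" where
  "tail S s = {t \<in> S. s \<le> t}"

text \<open>Plot the points (\<open>sum p (tail S s)\<close>, \<open>A s\<close>) together with the
  origin: \<open>h\<close> is the slope of their least concave majorant, so its tail sums majorize
  \<open>A\<close> and touch it where the slope changes. The induction takes the steepest chord from
  the origin, which settles the values from \<open>s0\<close> up, and restarts at the endpoint of
  that chord. The last clause is carried along so that the slopes found below \<open>s0\<close>
  cannot exceed \<open>m\<close>, which gives monotonicity.\<close>

lemma ironed_values_exist_bounded:
  fixes p A :: "real \<Rightarrow> real"
  assumes "finite S" "\<And>t. t \<in> S \<Longrightarrow> p t > 0"
  shows "\<exists>h. mono_on S h \<and>
     (\<forall>s\<in>S. A s \<le> (\<Sum>t\<in>tail S s. p t * h t)) \<and>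
     (\<forall>s\<in>S. (\<forall>t\<in>S. t < s \<longrightarrow> h t < h s) \<longrightarrow> A s = (\<Sum>t\<in>tail S s. p t * h t)) \<and>
     (\<forall>m. (\<forall>s\<in>S. A s \<le> m * sum p (tail S s)) \<longrightarrow> (\<forall>t\<in>S. h t \<le> m))"
  using assms
proof (induction "card S" arbitrary: S A rule: less_induct)
  case less
  show ?case
  proof (cases "S = {}")
    case True
    then show ?thesis by (auto simp: mono_on_def)
  next
    case False
    define Q where "Q s = sum p (tail S s)" for s
    have Qpos: "Q s > 0" if "s \<in> S" for s
      unfolding Q_def using that less.prems
      by (intro sum_pos) (auto simp: tail_def)
    define r where "r = (\<lambda>s. A s / Q s)"
    define m where "m = Max (r ` S)"
    have "m \<in> r ` S" unfolding m_def using less.prems False by (intro Max_in) auto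
    then obtain s0 where s0: "s0 \<in> S" "r s0 = m" by auto
    have rm: "r s \<le> m" if "s \<in> S" for s unfolding m_def using that less.prems by auto
    have Am: "A s \<le> m * Q s" if "s \<in> S" for s
      using rm[OF that] Qpos[OF that] by (simp add: r_def field_simps)
    have As0: "A s0 = m * Q s0" using s0 Qpos[of s0] by (auto simp: r_def field_simps)
    define S' where "S' = {t \<in> S. t < s0}"
    define A' where "A' s = A s - A s0" for s
    have tl: "tail S s = tail S' s \<union> tail S s0" "tail S' s \<inter> tail S s0 = {}" if "s \<in> S'" for s
      using that by (auto simp: tail_def S'_def)
    have fin: "finite (tail S' s)" "finite (tail S s)" for s
      using less.prems by (auto simp: tail_def S'_def)
    have "card S' < card S" using s0 less.prems by (intro psubset_card_mono) (auto simp: S'_def)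
    then obtain h' where h': "mono_on S' h'"
      "\<And>s. s \<in> S' \<Longrightarrow> A' s \<le> (\<Sum>t\<in>tail S' s. p t * h' t)"
      "\<And>s. s \<in> S' \<Longrightarrow> (\<forall>t\<in>S'. t < s \<longrightarrow> h' t < h' s) \<Longrightarrow> A' s = (\<Sum>t\<in>tail S' s. p t * h' t)"
      "\<And>m. (\<forall>s\<in>S'. A' s \<le> m * sum p (tail S' s)) \<Longrightarrow> (\<forall>t\<in>S'. h' t \<le> m)"
      using less.hyps[of S' A'] less.prems by (auto simp: S'_def)
    define h where "h t = (if t < s0 then h' t else m)" for t
    have Qs: "Q s = sum p (tail S' s) + Q s0" if "s \<in> S'" for s
      unfolding Q_def using fin tl[OF that] by (subst tl(1)[OF that]) (simp add: sum.union_disjoint)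
    have "\<forall>s\<in>S'. A' s \<le> m * sum p (tail S' s)"
    proof
      fix s assume s: "s \<in> S'"
      then have "A s \<le> m * Q s" by (intro Am) (auto simp: S'_def)
      then show "A' s \<le> m * sum p (tail S' s)"
        using Qs[OF s] As0 by (simp add: A'_def algebra_simps)
    qed
    then have h'm: "h' t \<le> m" if "t \<in> S'" for t using h'(4) that by blast
    have sum_top: "(\<Sum>t\<in>tail S s. p t * h t) = m * Q s" if "s0 \<le> s" for s
      unfolding Q_def sum_distrib_left using that
      by (intro sum.cong) (auto simp: tail_def h_def)
    have sum_low: "(\<Sum>t\<in>tail S s. p t * h t) = (\<Sum>t\<in>tail S' s. p t * h' t) + A s0" if "s \<in> S'" for s
    proof -
      have "(\<Sum>t\<in>tail S s. p t * h t) = (\<Sum>t\<in>tail S' s. p t * h t) + (\<Sum>t\<in>tail S s0. p t * h t)"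
        using fin tl[OF that] by (subst tl(1)[OF that]) (simp add: sum.union_disjoint)
      moreover have "(\<Sum>t\<in>tail S' s. p t * h t) = (\<Sum>t\<in>tail S' s. p t * h' t)"
        by (intro sum.cong) (auto simp: tail_def S'_def h_def)
      ultimately show ?thesis using sum_top[of s0] As0 by simp
    qed
    show ?thesis
    proof (intro exI[of _ h] conjI ballI allI impI)
      show "mono_on S h"
        using h'(1) h'm by (auto simp: mono_on_def h_def S'_def)
    next
      fix s assume s: "s \<in> S"
      show "A s \<le> (\<Sum>t\<in>tail S s. p t * h t)"
      proof (cases "s < s0")
        case True
        then have "s \<in> S'" using s by (auto simp: S'_def)
        then show ?thesis using sum_low h'(2)[of s] by (simp add: A'_def)
      next
        case False
        then show ?thesis using sum_top Am s by simp
      qed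
    next
      fix s assume s: "s \<in> S" and jump: "\<forall>t\<in>S. t < s \<longrightarrow> h t < h s"
      show "A s = (\<Sum>t\<in>tail S s. p t * h t)"
      proof (cases "s < s0")
        case True
        then have s': "s \<in> S'" using s by (auto simp: S'_def)
        moreover have "\<forall>t\<in>S'. t < s \<longrightarrow> h' t < h' s"
          using jump True by (auto simp: S'_def h_def)
        ultimately show ?thesis using sum_low[OF s'] h'(3)[of s] by (simp add: A'_def)
      next
        case False
        \<comment> \<open>On the values from \<open>s0\<close> up the slope is constantly
          \<open>m\<close>, so the only place for a jump there is \<open>s0\<close> itself.\<close>
        then have "s = s0" using jump s0 by (force simp: h_def)
        then show ?thesis using sum_top As0 by simp
      qed
    next
      fix n t assume n: "\<forall>s\<in>S. A s \<le> n * sum p (tail S s)" and t: "t \<in> S"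
      have "m \<le> n" using n s0 Qpos[of s0] As0 by (auto simp: Q_def[symmetric])
      then show "h t \<le> n" using h'm t by (force simp: h_def S'_def)
    qed
  qed
qed

section \<open>Threshold payments\<close>

text \<open>Here \<open>d s\<close> is the mass, not necessarily normalized, with which the price
  \<open>s\<close> is posted, and an agent of value \<open>t\<close> buys at every price up to
  \<open>t\<close>. The three sums are what this agent receives, pays and gains.\<close>

definition quantity :: "(real \<Rightarrow> real) \<Rightarrow> real set \<Rightarrow> real \<Rightarrow> real" where
  "quantity d S t = (\<Sum>s\<in>{s\<in>S. s \<le> t}. d s)"

definition price :: "(real \<Rightarrow> real) \<Rightarrow> real set \<Rightarrow> real \<Rightarrow> real" where
  "price d S t = (\<Sum>s\<in>{s\<in>S. s \<le> t}. d s * s)"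

definition rent :: "(real \<Rightarrow> real) \<Rightarrow> real set \<Rightarrow> real \<Rightarrow> real" where
  "rent d S t = (\<Sum>s\<in>{s\<in>S. s \<le> t}. d s * (t - s))"

lemma rent_eq: "rent d S t = t * quantity d S t - price d S t"
  unfolding rent_def quantity_def price_def sum_distrib_left sum_subtractf[symmetric]
  by (intro sum.cong) (auto simp: algebra_simps)

lemma rent_nonneg: "(\<And>s. s \<in> S \<Longrightarrow> 0 \<le> d s) \<Longrightarrow> 0 \<le> rent d S t"
  unfolding rent_def by (intro sum_nonneg) auto

text \<open>Reporting \<open>r\<close> means buying at exactly the prices up to \<open>r\<close>.
  The term \<open>d s * (t - s)\<close> is nonnegative for \<open>s\<close> up to \<open>t\<close>
  and nonpositive beyond, so the report \<open>t\<close> collects just the profitable ones.\<close>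

lemma rent_truthful:
  assumes "finite S" "\<And>s. s \<in> S \<Longrightarrow> 0 \<le> d s"
  shows "t * quantity d S r - price d S r \<le> rent d S t"
proof -
  have "t * quantity d S r - price d S r = (\<Sum>s\<in>{s\<in>S. s \<le> r}. d s * (t - s))"
    unfolding quantity_def price_def sum_distrib_left sum_subtractf[symmetric]
    by (intro sum.cong) (auto simp: algebra_simps)
  also have "\<dots> = (\<Sum>s\<in>S. if s \<le> r then d s * (t - s) else 0)"
    by (rule sum.inter_filter) (rule assms)
  also have "\<dots> \<le> (\<Sum>s\<in>S. if s \<le> t then d s * (t - s) else 0)"
    using assms(2) by (intro sum_mono) (auto simp: mult_nonneg_nonpos)
  also have "\<dots> = rent d S t"
    unfolding rent_def by (rule sum.inter_filter[symmetric]) (rule assms)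
  finally show ?thesis .
qed

lemma insert_top:
  assumes "\<forall>a\<in>S. a < (b::real)"
  shows "t < b \<Longrightarrow> {s\<in>insert b S. s \<le> t} = {s\<in>S. s \<le> t}"
        "b \<le> t \<Longrightarrow> {s\<in>insert b S. s \<le> t} = insert b S"
  using assms by auto

text \<open>The masses are the increments of \<open>X\<close> along \<open>S\<close>, the lowest
  point carrying the whole value of \<open>X\<close> there. Mass therefore sits only where
  \<open>X\<close> jumps; this clause later turns the ironing inequality into an equality.\<close>

lemma threshold_decomposition:
  fixes X :: "real \<Rightarrow> real"
  assumes "finite S" "mono_on S X" "\<And>t. t \<in> S \<Longrightarrow> 0 \<le> X t"
  shows "\<exists>d. (\<forall>s. 0 \<le> d s) \<and> (\<forall>t\<in>S. X t = quantity d S t) \<and>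
             (\<forall>s\<in>S. d s \<noteq> 0 \<longrightarrow> (\<forall>t\<in>S. t < s \<longrightarrow> X t < X s))"
  using assms
proof (induction rule: finite_linorder_max_induct)
  case empty
  then show ?case by (auto intro!: exI[of _ "\<lambda>_. 0"])
next
  case (insert b A)
  then obtain d where d: "\<forall>s. 0 \<le> d s" "\<forall>t\<in>A. X t = quantity d A t"
    "\<forall>s\<in>A. d s \<noteq> 0 \<longrightarrow> (\<forall>t\<in>A. t < s \<longrightarrow> X t < X s)"
    by (auto simp: mono_on_def)
  define d' where "d' = d(b := X b - sum d A)"
  have nb: "b \<notin> A" using insert.hyps by auto
  have low: "quantity d' (insert b A) t = X t" if "t \<in> A" for t
  proof -
    have "t < b" using that insert.hyps by auto
    then have "quantity d' (insert b A) t = quantity d A t"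
      unfolding quantity_def insert_top(1)[OF insert.hyps(2) \<open>t < b\<close>]
      using nb by (intro sum.cong) (auto simp: d'_def)
    then show ?thesis using d that by auto
  qed
  have top: "quantity d' (insert b A) b = X b"
  proof -
    have "sum d' A = sum d A" using nb by (intro sum.cong) (auto simp: d'_def)
    then show ?thesis
      using insert.hyps nb unfolding quantity_def insert_top(2)[OF insert.hyps(2) order_refl]
      by (simp add: d'_def)
  qed
  have sumA: "sum d A \<le> X b \<and> (sum d A \<noteq> X b \<longrightarrow> (\<forall>t\<in>A. X t < X b))"
  proof (cases "A = {}")
    case True
    then show ?thesis using insert.prems by auto
  next
    case False
    define m where "m = Max A"
    have m: "m \<in> A" "\<And>t. t \<in> A \<Longrightarrow> t \<le> m" using False insert.hyps by (auto simp: m_def)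
    have "{s \<in> A. s \<le> m} = A" using m by auto
    then have *: "X m = sum d A" using d(2) m(1) by (auto simp: quantity_def)
    have "X m \<le> X b" using insert.prems(1) insert.hyps m by (auto simp: mono_on_def less_imp_le)
    moreover have "X t \<le> X m" if "t \<in> A" for t
      using insert.prems(1) m that by (auto simp: mono_on_def)
    ultimately show ?thesis using * by force
  qed
  show ?case
  proof (intro exI[of _ d'] conjI allI ballI impI)
    fix s show "0 \<le> d' s" using d sumA by (auto simp: d'_def)
  next
    fix t assume "t \<in> insert b A"
    then show "X t = quantity d' (insert b A) t" using low top by auto
  next
    fix s t assume "s \<in> insert b A" "d' s \<noteq> 0" "t \<in> insert b A" "t < s"
    then show "X t < X s" using d sumA insert.hyps nb
      by (auto simp: d'_def split: if_splits)
  qed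
qed

text \<open>Only deviations to the next lower value matter. At the lowest value the rent is zero,
  and passing to the next value adds the gap times the quantity of the lower one, which is exactly
  what the deviation guarantees. Hence posted prices extract the largest payments compatible with
  \<open>X\<close>.\<close>

lemma rent_minimal:
  fixes X u :: "real \<Rightarrow> real"
  assumes "finite S" and d: "\<And>s. 0 \<le> d s" "\<And>t. t \<in> S \<Longrightarrow> X t = quantity d S t"
    and IR: "\<And>t. t \<in> S \<Longrightarrow> 0 \<le> u t"
    and IC: "\<And>t r. t \<in> S \<Longrightarrow> r \<in> S \<Longrightarrow> u r + (t - r) * X r \<le> u t"
  shows "\<forall>t\<in>S. rent d S t \<le> u t"
proof (rule ballI)
  fix t assume t: "t \<in> S"
  have "rent d S t \<le> u t"
    using t
  proof (induction "card {s\<in>S. s < t}" arbitrary: t rule: less_induct)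
    case less
    show ?case
    proof (cases "{s\<in>S. s < t} = {}")
      case True
      then have "rent d S t = 0" unfolding rent_def by (intro sum.neutral) auto
      then show ?thesis using IR less.prems by simp
    next
      case False
      define r where "r = Max {s\<in>S. s < t}"
      have "r \<in> {s\<in>S. s < t}" unfolding r_def using False \<open>finite S\<close> by (intro Max_in) auto
      then have r: "r \<in> S" "r < t" by auto
      have rmax: "s \<le> r" if "s \<in> S" "s < t" for s unfolding r_def using that \<open>finite S\<close> by auto
      have "card {s\<in>S. s < r} < card {s\<in>S. s < t}"
        using r \<open>finite S\<close> by (intro psubset_card_mono) auto
      then have ih: "rent d S r \<le> u r" using less.hyps r by auto
      have eq: "{s\<in>S. s \<le> t} = insert t {s\<in>S. s \<le> r}"
        using rmax r less.prems by force
      have "rent d S t = (\<Sum>s\<in>{s\<in>S. s \<le> r}. d s * (t - s))"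
        unfolding rent_def eq using \<open>finite S\<close> r by (subst sum.insert) auto
      also have "\<dots> = rent d S r + (t - r) * quantity d S r"
        unfolding rent_def quantity_def sum_distrib_left sum.distrib[symmetric]
        by (intro sum.cong) (auto simp: algebra_simps)
      also have "\<dots> \<le> u t" using ih IC[OF less.prems r(1)] d(2)[OF r(1)] by simp
      finally show ?thesis .
    qed
  qed
  then show "rent d S t \<le> u t" .
qed

section \<open>Ironed values\<close>

text \<open>The contribution to the objective GFT + \<open>\<alpha>\<close> Rev of posting the price \<open>s\<close> to an agent with value
  weights \<open>p\<close>. Throughout, a seller of cost \<open>c\<close> is an agent of value \<open>-c\<close>.\<close>

definition posted :: "real \<Rightarrow> (real \<Rightarrow> real) \<Rightarrow> real set \<Rightarrow> real \<Rightarrow> real" where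
  "posted \<alpha> p S s = (\<Sum>t\<in>tail S s. p t * (t + \<alpha> * s))"

text \<open>Exchanging the sums attributes the payoff to posted prices instead of agent values. The
  objective becomes linear in \<open>d\<close>, and ironing can be applied coefficient by
  coefficient.\<close>

lemma sum_thresholds:
  fixes p d :: "real \<Rightarrow> real"
  assumes "finite S"
  shows "(\<Sum>t\<in>S. p t * (\<Sum>s\<in>{s\<in>S. s \<le> t}. d s * k s t)) = (\<Sum>s\<in>S. d s * (\<Sum>t\<in>tail S s. p t * k s t))"
proof -
  have "(\<Sum>t\<in>S. p t * (\<Sum>s\<in>{s\<in>S. s \<le> t}. d s * k s t)) = (\<Sum>t\<in>S. \<Sum>s\<in>S. if s \<le> t then d s * (p t * k s t) else (0::real))"
    using assms by (intro sum.cong) (auto simp: sum.inter_filter sum_distrib_left algebra_simps intro!: sum.cong)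
  also have "\<dots> = (\<Sum>s\<in>S. \<Sum>t\<in>S. if s \<le> t then d s * (p t * k s t) else 0)"
    by (rule sum.swap)
  also have "\<dots> = (\<Sum>s\<in>S. d s * (\<Sum>t\<in>tail S s. p t * k s t))"
    using assms unfolding tail_def by (intro sum.cong) (auto simp: sum.inter_filter sum_distrib_left algebra_simps intro!: sum.cong)
  finally show ?thesis .
qed

lemma sum_posted:
  assumes "finite S"
  shows "(\<Sum>t\<in>S. p t * (t * quantity d S t + \<alpha> * price d S t)) = (\<Sum>s\<in>S. d s * posted \<alpha> p S s)"
proof -
  have "t * quantity d S t + \<alpha> * price d S t = (\<Sum>s\<in>{s\<in>S. s \<le> t}. d s * (t + \<alpha> * s))" for t
    unfolding quantity_def price_def sum_distrib_left sum.distrib[symmetric]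
    by (intro sum.cong) (auto simp: algebra_simps)
  then show ?thesis using sum_thresholds[OF assms, of p d "\<lambda>s t. t + \<alpha> * s"]
    by (simp add: posted_def)
qed

lemma sum_weighted_quantity:
  assumes "finite S"
  shows "(\<Sum>t\<in>S. p t * (h t * quantity d S t)) = (\<Sum>s\<in>S. d s * (\<Sum>t\<in>tail S s. p t * h t))"
proof -
  have "h t * quantity d S t = (\<Sum>s\<in>{s\<in>S. s \<le> t}. d s * h t)" for t
    by (simp add: quantity_def sum_distrib_left mult.commute)
  then show ?thesis using sum_thresholds[OF assms, of p d "\<lambda>s t. h t"] by simp
qed

text \<open>The slope of the least concave majorant of \<open>posted\<close> over the tail mass. The
  inequality bounds arbitrary threshold rules from above (\<open>ironed_upper\<close>); the equality
  at jumps makes the bound exact for rules whose thresholds lie at jumps of \<open>h\<close>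
  (\<open>ironed_eq\<close>).\<close>

definition ironed :: "real \<Rightarrow> (real \<Rightarrow> real) \<Rightarrow> real set \<Rightarrow> (real \<Rightarrow> real) \<Rightarrow> bool" where
  "ironed \<alpha> p S h \<longleftrightarrow> mono_on S h \<and>
     (\<forall>s\<in>S. posted \<alpha> p S s \<le> (\<Sum>t\<in>tail S s. p t * h t)) \<and>
     (\<forall>s\<in>S. (\<forall>t\<in>S. t < s \<longrightarrow> h t < h s) \<longrightarrow> posted \<alpha> p S s = (\<Sum>t\<in>tail S s. p t * h t))"

lemma ironed_exists:
  assumes "finite S" "\<And>t. t \<in> S \<Longrightarrow> p t > 0"
  shows "\<exists>h. ironed \<alpha> p S h"
  using ironed_values_exist_bounded[of S p "posted \<alpha> p S", OF assms] unfolding ironed_def by blast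

lemma ironed_upper:
  assumes "ironed \<alpha> p S h" "finite S" "\<And>s. 0 \<le> d s"
  shows "(\<Sum>t\<in>S. p t * (t * quantity d S t + \<alpha> * price d S t)) \<le> (\<Sum>t\<in>S. p t * (h t * quantity d S t))"
  unfolding sum_posted[OF assms(2)] sum_weighted_quantity[OF assms(2)]
  using assms by (intro sum_mono mult_left_mono) (auto simp: ironed_def)

lemma ironed_eq:
  assumes "ironed \<alpha> p S h" "finite S"
    and "\<And>s t. s \<in> S \<Longrightarrow> d s \<noteq> 0 \<Longrightarrow> t \<in> S \<Longrightarrow> t < s \<Longrightarrow> h t < h s"
  shows "(\<Sum>t\<in>S. p t * (t * quantity d S t + \<alpha> * price d S t)) = (\<Sum>t\<in>S. p t * (h t * quantity d S t))"
  unfolding sum_posted[OF assms(2)] sum_weighted_quantity[OF assms(2)]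
proof (intro sum.cong refl)
  fix s assume "s \<in> S"
  then show "d s * posted \<alpha> p S s = d s * (\<Sum>t\<in>tail S s. p t * h t)"
    using assms(1,3) by (cases "d s = 0") (auto simp: ironed_def)
qed

section \<open>The cheapest thresholds\<close>

text \<open>The lines over which \<open>surplus\<close> takes the minimum come from Lagrange multipliers \<open>l\<close> for
  the quantity \<open>q\<close> bought from the seller.\<close>

definition surplus :: "real \<Rightarrow> real set \<Rightarrow> (real \<Rightarrow> real) \<Rightarrow> real \<Rightarrow> real \<Rightarrow> real" where
  "surplus \<alpha> \<Lambda> C v q = Min ((\<lambda>l. (1 + \<alpha>) * v * q + l * q + C l) ` \<Lambda>)"

lemma surplus_le: "finite \<Lambda> \<Longrightarrow> l \<in> \<Lambda> \<Longrightarrow> surplus \<alpha> \<Lambda> C v q \<le> (1 + \<alpha>) * v * q + l * q + C l"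
  by (simp add: surplus_def)

lemma le_surplus: "finite \<Lambda> \<Longrightarrow> \<Lambda> \<noteq> {} \<Longrightarrow>
    z \<le> surplus \<alpha> \<Lambda> C v q \<longleftrightarrow> (\<forall>l\<in>\<Lambda>. z \<le> (1 + \<alpha>) * v * q + l * q + C l)"
  by (simp add: surplus_def)

text \<open>The buyer value enters all lines through one common term, which passes through the
  minimum. So the seller part of the surplus is the same for all buyer values.\<close>

lemma surplus_shift:
  assumes "finite \<Lambda>" "\<Lambda> \<noteq> {}"
  shows "surplus \<alpha> \<Lambda> C w q = surplus \<alpha> \<Lambda> C v q + (1 + \<alpha>) * (w - v) * q"
proof (rule antisym)
  show "surplus \<alpha> \<Lambda> C v q + (1 + \<alpha>) * (w - v) * q \<le> surplus \<alpha> \<Lambda> C w q"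
    unfolding le_surplus[OF assms]
  proof
    fix l assume "l \<in> \<Lambda>"
    from surplus_le[OF assms(1) this, of \<alpha> C v q]
    show "surplus \<alpha> \<Lambda> C v q + (1 + \<alpha>) * (w - v) * q \<le> (1 + \<alpha>) * w * q + l * q + C l"
      by (simp add: algebra_simps)
  qed
  have "surplus \<alpha> \<Lambda> C w q - (1 + \<alpha>) * (w - v) * q \<le> surplus \<alpha> \<Lambda> C v q"
    unfolding le_surplus[OF assms]
  proof
    fix l assume "l \<in> \<Lambda>"
    from surplus_le[OF assms(1) this, of \<alpha> C w q]
    show "surplus \<alpha> \<Lambda> C w q - (1 + \<alpha>) * (w - v) * q \<le> (1 + \<alpha>) * v * q + l * q + C l"
      by (simp add: algebra_simps)
  qed
  then show "surplus \<alpha> \<Lambda> C w q \<le> surplus \<alpha> \<Lambda> C v q + (1 + \<alpha>) * (w - v) * q" by simp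
qed

lemma continuous_on_surplus:
  assumes "finite \<Lambda>" "\<Lambda> \<noteq> {}"
  shows "continuous_on T (surplus \<alpha> \<Lambda> C v)"
  using assms unfolding surplus_def
proof (induction \<Lambda> rule: finite_ne_induct)
  case (singleton l)
  then show ?case by (auto intro!: continuous_intros)
next
  case (insert l L)
  have "(\<lambda>q. Min ((\<lambda>l. (1 + \<alpha>) * v * q + l * q + C l) ` insert l L)) =
        (\<lambda>q. min ((1 + \<alpha>) * v * q + l * q + C l) (Min ((\<lambda>l. (1 + \<alpha>) * v * q + l * q + C l) ` L)))"
    using insert.hyps by auto
  then show ?case using insert.IH
    by (simp only:) (auto intro!: continuous_intros continuous_on_min)
qed

lemma quantity_nonneg: "(\<And>s. 0 \<le> d s) \<Longrightarrow> 0 \<le> quantity d S t"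
  unfolding quantity_def by (intro sum_nonneg) auto

lemma rent_above:
  assumes "\<forall>a\<in>A. a \<le> b" "b \<le> w"
  shows "rent d A w = rent d A b + (w - b) * sum d A"
proof -
  have "{s\<in>A. s \<le> w} = A" "{s\<in>A. s \<le> b} = A" using assms by auto
  then have "rent d A w = (\<Sum>s\<in>A. d s * (b - s) + (w - b) * d s)" "rent d A b = (\<Sum>s\<in>A. d s * (b - s))"
    unfolding rent_def by (auto simp: algebra_simps intro!: sum.cong)
  then show ?thesis by (simp add: sum.distrib sum_distrib_left)
qed

text \<open>Buyer values are served in increasing order, each time with the least quantity whose surplus net
  of the rent so far reaches \<open>\<kappa>\<close>. The induction carries multipliers \<open>f\<close> certifying that no other
  thresholds leave less rent. If the next value cannot be served within the capacity \<open>\<Gamma>\<close>, these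
  multipliers, read as a buyer distribution, contradict the last hypothesis.\<close>

lemma exists_cheapest_thresholds:
  fixes \<kappa> \<Gamma> C :: "real \<Rightarrow> real"
  assumes \<Lambda>: "finite \<Lambda>" "\<Lambda> \<noteq> {}" and \<alpha>: "\<alpha> \<ge> 0" and A: "finite A"
    and "\<And>v w. v \<in> A \<Longrightarrow> w \<in> A \<Longrightarrow> v \<le> w \<Longrightarrow> \<Gamma> v \<le> \<Gamma> w"
    and "\<And>v. v \<in> A \<Longrightarrow> 0 \<le> \<Gamma> v"
    and "\<And>b f \<epsilon>. b \<in> A \<Longrightarrow> \<forall>v. 0 \<le> f v \<Longrightarrow> f b = 1 \<Longrightarrow> \<epsilon> > 0 \<Longrightarrow>
      \<exists>d. (\<forall>s. 0 \<le> d s) \<and> quantity d A b \<le> \<Gamma> b \<and>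
        - \<epsilon> \<le> (\<Sum>v\<in>{v\<in>A. v \<le> b}. f v * (surplus \<alpha> \<Lambda> C v (quantity d A v) - \<alpha> * rent d A v - \<kappa> v))"
  shows "\<exists>x. (\<forall>s. 0 \<le> x s) \<and>
    (\<forall>v\<in>A. quantity x A v \<le> \<Gamma> v \<and> \<kappa> v \<le> surplus \<alpha> \<Lambda> C v (quantity x A v) - \<alpha> * rent x A v)"
proof -
  \<comment> \<open>As \<open>price\<close> is \<open>v * quantity\<close> minus
    \<open>rent\<close>, this equals \<open>v * q + \<alpha> * price\<close> plus the seller part
    \<open>surplus \<alpha> \<Lambda> C 0 q\<close> for the quantity \<open>q\<close> bought at
    \<open>v\<close>.\<close>
  define J where "J A d v = surplus \<alpha> \<Lambda> C v (quantity d A v) - \<alpha> * rent d A v" for A d v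
  \<comment> \<open>The certificate is weak duality: a \<open>d\<close> meeting all demands makes
    the left side nonnegative, so it leaves at least the rent of \<open>x\<close> at
    \<open>w\<close>. It is claimed for every later \<open>w\<close>, since the next value is not
    yet known. The final clause says that quantities below the current total offer no more surplus
    at \<open>w\<close>, so the next quantity may be sought above that total only.\<close>
  have "\<exists>x. (\<forall>s. 0 \<le> x s) \<and> (\<forall>v\<in>A. quantity x A v \<le> \<Gamma> v \<and> \<kappa> v \<le> J A x v) \<and>
     (\<forall>w. (\<forall>a\<in>A. a \<le> w) \<longrightarrow>
        (\<exists>f. (\<forall>v. 0 \<le> f v) \<and>
           (\<forall>d. (\<forall>s. 0 \<le> d s) \<longrightarrow> (\<Sum>v\<in>A. f v * (J A d v - \<kappa> v)) \<le> rent d A w - rent x A w)) \<and>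
        (\<forall>q. 0 \<le> q \<longrightarrow> q \<le> sum x A \<longrightarrow> surplus \<alpha> \<Lambda> C w q \<le> surplus \<alpha> \<Lambda> C w (sum x A)))"
    using A assms(5-7) unfolding J_def[symmetric]
  proof (induction A rule: finite_linorder_max_induct)
    case empty
    then show ?case
      by (auto intro!: exI[of _ "\<lambda>_. 0"] simp: rent_def)
  next
    case (insert b A)
    have nb: "b \<notin> A" using insert.hyps by auto
    have q_low: "quantity d (insert b A) v = quantity d A v"
      and r_low: "rent d (insert b A) v = rent d A v" if "v \<in> A" for d v
      using that insert_top(1)[OF insert.hyps(2)] insert.hyps(2) by (auto simp: quantity_def rent_def)
    have J_low: "J (insert b A) d v = J A d v" if "v \<in> A" for d v
      using q_low r_low that by (simp add: J_def)
    have filt: "{v \<in> insert b A. v \<le> b'} = {v \<in> A. v \<le> b'}" if "b' \<in> A" for b'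
      using that insert_top(1)[OF insert.hyps(2)] insert.hyps(2) by auto
    have q_top: "quantity d (insert b A) b = d b + sum d A" for d
      unfolding quantity_def insert_top(2)[OF insert.hyps(2) order_refl] using nb insert.hyps by simp
    have r_top: "rent d (insert b A) w = rent d A b + (w - b) * quantity d (insert b A) b" if "b \<le> w" for d w
    proof -
      have "{s\<in>A. s \<le> b} = A" using insert.hyps(2) by auto
      then show ?thesis
        unfolding rent_def q_top insert_top(2)[OF insert.hyps(2) that] using nb insert.hyps(1)
        by (simp add: sum_distrib_left sum.distrib[symmetric] algebra_simps cong: sum.cong)
    qed
    have top_le: "\<forall>a\<in>A. a \<le> b" using insert.hyps(2) by auto
    have "\<exists>x. (\<forall>s. 0 \<le> x s) \<and> (\<forall>v\<in>A. quantity x A v \<le> \<Gamma> v \<and> \<kappa> v \<le> J A x v) \<and>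
     (\<forall>w. (\<forall>a\<in>A. a \<le> w) \<longrightarrow>
        (\<exists>f. (\<forall>v. 0 \<le> f v) \<and>
           (\<forall>d. (\<forall>s. 0 \<le> d s) \<longrightarrow> (\<Sum>v\<in>A. f v * (J A d v - \<kappa> v)) \<le> rent d A w - rent x A w)) \<and>
        (\<forall>q. 0 \<le> q \<longrightarrow> q \<le> sum x A \<longrightarrow> surplus \<alpha> \<Lambda> C w q \<le> surplus \<alpha> \<Lambda> C w (sum x A)))"
    proof (rule insert.IH)
      fix b' f \<epsilon> assume b': "b' \<in> A" "\<forall>v. 0 \<le> f v" "f b' = (1::real)" "\<epsilon> > (0::real)"
      then obtain d where "\<forall>s. 0 \<le> d s" "quantity d (insert b A) b' \<le> \<Gamma> b'"
        "- \<epsilon> \<le> (\<Sum>v\<in>{v\<in>insert b A. v \<le> b'}. f v * (J (insert b A) d v - \<kappa> v))"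
        using insert.prems(3)[of b' f \<epsilon>] by auto
      then show "\<exists>d. (\<forall>s. 0 \<le> d s) \<and> quantity d A b' \<le> \<Gamma> b' \<and>
        - \<epsilon> \<le> (\<Sum>v\<in>{v\<in>A. v \<le> b'}. f v * (J A d v - \<kappa> v))"
        unfolding filt[OF b'(1)] using q_low[OF b'(1)] J_low
        by (auto intro!: exI[of _ d])
    qed (use insert.prems in auto)
    then obtain x where x0: "\<And>s. 0 \<le> x s"
      and xJ: "\<And>v. v \<in> A \<Longrightarrow> quantity x A v \<le> \<Gamma> v" "\<And>v. v \<in> A \<Longrightarrow> \<kappa> v \<le> J A x v"
      and cert: "\<And>w. (\<forall>a\<in>A. a \<le> w) \<Longrightarrow> (\<exists>f. (\<forall>v. 0 \<le> f v) \<and>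
           (\<forall>d. (\<forall>s. 0 \<le> d s) \<longrightarrow> (\<Sum>v\<in>A. f v * (J A d v - \<kappa> v)) \<le> rent d A w - rent x A w))"
      and incr: "\<And>w q. (\<forall>a\<in>A. a \<le> w) \<Longrightarrow> 0 \<le> q \<Longrightarrow> q \<le> sum x A \<Longrightarrow>
             surplus \<alpha> \<Lambda> C w q \<le> surplus \<alpha> \<Lambda> C w (sum x A)"
      by blast
    define X where "X = sum x A"
    \<comment> \<open>The rent at \<open>b\<close> is fixed by the thresholds below
      \<open>b\<close>, so meeting the demand \<open>\<kappa> b\<close> amounts to a surplus of at
      least \<open>\<tau>\<close>.\<close>
    define \<tau> where "\<tau> = \<kappa> b + \<alpha> * rent x A b"
    have X0: "0 \<le> X" unfolding X_def using x0 by (simp add: sum_nonneg)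
    have XG: "X \<le> \<Gamma> b"
    proof (cases "A = {}")
      case True
      then show ?thesis using insert.prems(2) by (simp add: X_def)
    next
      case False
      define m where "m = Max A"
      have m: "m \<in> A" "\<And>t. t \<in> A \<Longrightarrow> t \<le> m" using False insert.hyps by (auto simp: m_def)
      then have "{s\<in>A. s \<le> m} = A" by auto
      then have "X = quantity x A m" by (simp add: X_def quantity_def)
      also have "\<dots> \<le> \<Gamma> b" using xJ(1)[OF m(1)] insert.prems(1)[of m b] m insert.hyps(2) by force
      finally show ?thesis .
    qed
    obtain f where f: "\<And>v. 0 \<le> f v"
      "\<And>d. (\<forall>s. 0 \<le> d s) \<Longrightarrow> (\<Sum>v\<in>A. f v * (J A d v - \<kappa> v)) \<le> rent d A b - rent x A b"
      using cert[OF top_le] by blast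
    have "\<exists>q\<ge>X. q \<le> \<Gamma> b \<and> \<tau> \<le> surplus \<alpha> \<Lambda> C b q"
    proof (rule ccontr)
      assume no: "\<not> ?thesis"
      have less: "surplus \<alpha> \<Lambda> C b q < \<tau>" if "q \<in> {0..\<Gamma> b}" for q
      proof (cases "X \<le> q")
        case True
        then show ?thesis using no that by auto
      next
        case False
        then have "surplus \<alpha> \<Lambda> C b q \<le> surplus \<alpha> \<Lambda> C b X"
          using incr[OF top_le] that by (auto simp: X_def)
        also have "\<dots> < \<tau>" using no XG by force
        finally show ?thesis .
      qed
      \<comment> \<open>Compactness turns failure at each single quantity into a uniform gap
        \<open>\<delta>\<close>, which outweighs the slack \<open>\<delta>/2\<close> left to the
        hypothesis.\<close>
      obtain q1 where q1: "q1 \<in> {0..\<Gamma> b}" "\<And>q. q \<in> {0..\<Gamma> b} \<Longrightarrow> surplus \<alpha> \<Lambda> C b q \<le> surplus \<alpha> \<Lambda> C b q1"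
        using continuous_attains_sup[of "{0..\<Gamma> b}" "surplus \<alpha> \<Lambda> C b"] continuous_on_surplus[OF \<Lambda>]
          insert.prems(2)[of b] by auto
      define \<delta> where "\<delta> = \<tau> - surplus \<alpha> \<Lambda> C b q1"
      have \<delta>: "\<delta> > 0" using less[OF q1(1)] by (simp add: \<delta>_def)
      \<comment> \<open>A rival \<open>d\<close> could do better at \<open>b\<close> only by leaving
        less rent there, and rent enters \<open>J\<close> with the factor \<open>\<alpha>\<close>.
        Adding \<open>\<alpha>\<close> times the certificate cancels precisely this gain.\<close>
      define F where "F v = (if v = b then 1 else \<alpha> * f v)" for v
      have "\<forall>v. 0 \<le> F v" using f \<alpha> by (auto simp: F_def)
      then obtain d where d: "\<forall>s. 0 \<le> d s" "quantity d (insert b A) b \<le> \<Gamma> b"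
        "- (\<delta>/2) \<le> (\<Sum>v\<in>{v\<in>insert b A. v \<le> b}. F v * (J (insert b A) d v - \<kappa> v))"
        using insert.prems(3)[of b F "\<delta>/2"] \<delta> by (auto simp: F_def)
      have "(\<Sum>v\<in>{v\<in>insert b A. v \<le> b}. F v * (J (insert b A) d v - \<kappa> v)) =
            (J (insert b A) d b - \<kappa> b) + \<alpha> * (\<Sum>v\<in>A. f v * (J A d v - \<kappa> v))"
      proof -
        have "(\<Sum>v\<in>A. F v * (J (insert b A) d v - \<kappa> v)) = \<alpha> * (\<Sum>v\<in>A. f v * (J A d v - \<kappa> v))"
          unfolding sum_distrib_left using nb by (intro sum.cong) (auto simp: F_def J_low)
        moreover have "F b = 1" by (simp add: F_def)
        ultimately show ?thesis
          unfolding insert_top(2)[OF insert.hyps(2) order_refl] using nb insert.hyps(1)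
          by (simp add: sum.insert)
      qed
      moreover have "J (insert b A) d b \<le> \<tau> - \<delta> - \<alpha> * rent d A b"
        using q1(2)[of "quantity d (insert b A) b"] d quantity_nonneg[of d "insert b A" b] r_top[OF order_refl, of d]
        by (simp add: J_def \<delta>_def)
      moreover have "\<alpha> * (\<Sum>v\<in>A. f v * (J A d v - \<kappa> v)) \<le> \<alpha> * (rent d A b - rent x A b)"
        using f(2) d \<alpha> by (intro mult_left_mono) auto
      ultimately have "- (\<delta>/2) \<le> - \<delta>" using d(3) by (simp add: \<tau>_def algebra_simps)
      then show False using \<delta> by simp
    qed
    then obtain q0 where q0: "X \<le> q0" "q0 \<le> \<Gamma> b" "\<tau> \<le> surplus \<alpha> \<Lambda> C b q0" by blast
    define \<sigma> where "\<sigma> l = (1 + \<alpha>) * b + l" for l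
    have line: "(1 + \<alpha>) * b * q + l * q + C l = \<sigma> l * q + C l" for l q
      by (simp add: \<sigma>_def algebra_simps)
    define P where "P = {l\<in>\<Lambda>. \<sigma> l > 0}"
    \<comment> \<open>The least quantity from \<open>X\<close> up at which every increasing line has
      reached \<open>\<tau>\<close>. The other lines reach \<open>\<tau>\<close> at
      \<open>q0\<close>, and moving down from \<open>q0\<close> to \<open>X'\<close> does not lower
      them.\<close>
    define X' where "X' = Max (insert X ((\<lambda>l. (\<tau> - C l) / \<sigma> l) ` P))"
    have finP: "finite P" using \<Lambda> by (simp add: P_def)
    have XX': "X \<le> X'" unfolding X'_def using finP by auto
    have root: "(\<tau> - C l) / \<sigma> l \<le> q0" if "l \<in> P" for l
    proof -
      have "\<tau> \<le> \<sigma> l * q0 + C l" using q0(3) that \<Lambda> by (auto simp: le_surplus line P_def)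
      then show ?thesis using that by (simp add: P_def field_simps)
    qed
    have X'q: "X' \<le> q0" unfolding X'_def using finP q0 root by auto
    have X'\<tau>: "\<tau> \<le> surplus \<alpha> \<Lambda> C b X'"
      unfolding le_surplus[OF \<Lambda>] line
    proof
      fix l assume l: "l \<in> \<Lambda>"
      show "\<tau> \<le> \<sigma> l * X' + C l"
      proof (cases "\<sigma> l > 0")
        case True
        then have "(\<tau> - C l) / \<sigma> l \<le> X'" unfolding X'_def using l finP by (intro Max_ge) (auto simp: P_def)
        then show ?thesis using True by (simp add: field_simps)
      next
        case False
        then have "\<sigma> l * q0 \<le> \<sigma> l * X'" using X'q by (simp add: mult_left_mono_neg)
        moreover have "\<tau> \<le> \<sigma> l * q0 + C l" using q0(3) l \<Lambda> by (auto simp: le_surplus line)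
        ultimately show ?thesis by simp
      qed
    qed
    define x' where "x' = x(b := X' - X)"
    have x'A: "quantity x' A v = quantity x A v" "rent x' A v = rent x A v" "sum x' A = X" for v
      unfolding quantity_def rent_def X_def using nb by (auto simp: x'_def intro!: sum.cong)
    have x'0: "0 \<le> x' s" for s using x0 XX' by (simp add: x'_def)
    have x'b: "quantity x' (insert b A) b = X'" "sum x' (insert b A) = X'"
      using q_top[of x'] x'A nb insert.hyps(1) by (auto simp: x'_def)
    show ?case
    proof (rule exI[of _ x'], intro conjI allI impI ballI)
      fix s show "0 \<le> x' s" by (rule x'0)
    next
      fix v assume "v \<in> insert b A"
      then consider "v = b" | "v \<in> A" by auto
      then show "quantity x' (insert b A) v \<le> \<Gamma> v"
      proof cases
        case 1
        then show ?thesis using x'b X'q q0 by simp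
      next
        case 2
        then show ?thesis using q_low x'A xJ(1) by simp
      qed
    next
      fix v assume "v \<in> insert b A"
      then consider "v = b" | "v \<in> A" by auto
      then show "\<kappa> v \<le> J (insert b A) x' v"
      proof cases
        case 1
        then show ?thesis using X'\<tau> x'b r_top[OF order_refl, of x'] x'A by (simp add: J_def \<tau>_def)
      next
        case 2
        then have "J (insert b A) x' v = J A x v" using J_low x'A by (simp add: J_def)
        then show ?thesis using xJ(2) 2 by simp
      qed
    next
      fix w assume w: "\<forall>a\<in>insert b A. a \<le> w"
      then have bw: "b \<le> w" by simp
      show "\<exists>f. (\<forall>v. 0 \<le> f v) \<and> (\<forall>d. (\<forall>s. 0 \<le> d s) \<longrightarrow>
          (\<Sum>v\<in>insert b A. f v * (J (insert b A) d v - \<kappa> v)) \<le> rent d (insert b A) w - rent x' (insert b A) w)"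
      proof (cases "X' = X")
        case True
        obtain g where g: "\<And>v. 0 \<le> g v"
          "\<And>d. (\<forall>s. 0 \<le> d s) \<Longrightarrow> (\<Sum>v\<in>A. g v * (J A d v - \<kappa> v)) \<le> rent d A w - rent x A w"
          using cert[of w] w by auto
        \<comment> \<open>Nothing is bought at \<open>b\<close>, so the certificate of the smaller
          set for the same \<open>w\<close> is kept with multiplier 0 at \<open>b\<close>; mass that
          a rival puts on \<open>b\<close> can only add rent.\<close>
        define g' where "g' = g(b := 0)"
        show ?thesis
        proof (intro exI[of _ g'] conjI allI impI)
          fix v show "0 \<le> g' v" using g by (simp add: g'_def)
        next
          fix d :: "real \<Rightarrow> real" assume d: "\<forall>s. 0 \<le> d s"
          have "(\<Sum>v\<in>insert b A. g' v * (J (insert b A) d v - \<kappa> v)) = (\<Sum>v\<in>A. g v * (J A d v - \<kappa> v))"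
          proof -
            have "(\<Sum>v\<in>A. g' v * (J (insert b A) d v - \<kappa> v)) = (\<Sum>v\<in>A. g v * (J A d v - \<kappa> v))"
              using nb by (intro sum.cong) (auto simp: g'_def J_low)
            moreover have "g' b = 0" by (simp add: g'_def)
            ultimately show ?thesis using nb insert.hyps(1) by simp
          qed
          also have "\<dots> \<le> rent d A w - rent x A w" by (rule g(2)[OF d])
          also have "rent d A w \<le> rent d (insert b A) w"
            using d bw r_top[OF bw, of d] rent_above[OF top_le bw, of d] q_top[of d] by (simp add: mult_left_mono)
          also have "rent x A w = rent x' (insert b A) w"
            using r_top[OF bw, of x'] rent_above[OF top_le bw, of x] x'A x'b True by (simp add: X_def)
          finally show "(\<Sum>v\<in>insert b A. g' v * (J (insert b A) d v - \<kappa> v)) \<le> rent d (insert b A) w - rent x' (insert b A) w"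
            by simp
        qed
      next
        case False
        have "X' \<in> insert X ((\<lambda>l. (\<tau> - C l) / \<sigma> l) ` P)" unfolding X'_def using finP by (intro Max_in) auto
        then obtain l where l: "l \<in> \<Lambda>" "\<sigma> l > 0" "X' = (\<tau> - C l) / \<sigma> l" using False by (auto simp: P_def)
        \<comment> \<open>The rent at \<open>w\<close> is the rent at \<open>b\<close> plus
          \<open>w - b\<close> times the quantity at \<open>b\<close>. Along the binding line
          \<open>l\<close> that quantity exceeds \<open>X'\<close> by at least the excess of
          \<open>J\<close> at \<open>b\<close> plus \<open>\<alpha> * D\<close>, divided by
          \<open>\<sigma> l\<close>. So the rent difference \<open>D\<close> counts once directly
          and once through the quantity, which explains the factor on \<open>f\<close>.\<close>
        define g where "g v = (if v = b then (w - b) / \<sigma> l else (1 + (w - b) * \<alpha> / \<sigma> l) * f v)" for v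
        show ?thesis
        proof (intro exI[of _ g] conjI allI impI)
          fix v show "0 \<le> g v" using f bw l \<alpha> by (auto simp: g_def)
        next
          fix d :: "real \<Rightarrow> real" assume d: "\<forall>s. 0 \<le> d s"
          define q where "q = quantity d (insert b A) b"
          define D where "D = rent d A b - rent x A b"
          have "J (insert b A) d b \<le> \<sigma> l * q + C l - \<alpha> * rent d A b"
            using surplus_le[OF \<Lambda>(1) l(1), of \<alpha> C b q] r_top[OF order_refl, of d]
            by (simp add: J_def q_def line)
          moreover have "\<sigma> l * X' = \<tau> - C l" using l by simp
          ultimately have "(J (insert b A) d b - \<kappa> b) + \<alpha> * D \<le> \<sigma> l * (q - X')"
            by (simp add: D_def \<tau>_def algebra_simps)
          then have qX: "((J (insert b A) d b - \<kappa> b) + \<alpha> * D) / \<sigma> l \<le> q - X'"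
            using l(2) by (simp add: pos_divide_le_eq mult.commute)
          have "(\<Sum>v\<in>insert b A. g v * (J (insert b A) d v - \<kappa> v)) =
             (w - b) / \<sigma> l * (J (insert b A) d b - \<kappa> b) + (1 + (w - b) * \<alpha> / \<sigma> l) * (\<Sum>v\<in>A. f v * (J A d v - \<kappa> v))"
          proof -
            have "(\<Sum>v\<in>A. g v * (J (insert b A) d v - \<kappa> v)) = (1 + (w - b) * \<alpha> / \<sigma> l) * (\<Sum>v\<in>A. f v * (J A d v - \<kappa> v))"
              unfolding sum_distrib_left using nb by (intro sum.cong) (auto simp: g_def J_low)
            moreover have "g b = (w - b) / \<sigma> l" by (simp add: g_def)
            ultimately show ?thesis using nb insert.hyps(1) by simp
          qed
          also have "\<dots> \<le> (w - b) / \<sigma> l * (J (insert b A) d b - \<kappa> b) + (1 + (w - b) * \<alpha> / \<sigma> l) * D"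
            using f(2)[OF d] bw l \<alpha> unfolding D_def by (intro add_left_mono mult_left_mono) auto
          also have "\<dots> = D + (w - b) * (((J (insert b A) d b - \<kappa> b) + \<alpha> * D) / \<sigma> l)"
            using l(2) by (simp add: field_simps)
          also have "\<dots> \<le> D + (w - b) * (q - X')"
            using qX bw by (intro add_left_mono mult_left_mono) auto
          also have "\<dots> = rent d (insert b A) w - rent x' (insert b A) w"
            using r_top[OF bw, of d] r_top[OF bw, of x'] x'A x'b by (simp add: D_def q_def algebra_simps)
          finally show "(\<Sum>v\<in>insert b A. g v * (J (insert b A) d v - \<kappa> v)) \<le> rent d (insert b A) w - rent x' (insert b A) w" .
        qed
      qed
    next
      fix w q :: real
      assume w: "\<forall>a\<in>insert b A. a \<le> w" and q: "0 \<le> q" "q \<le> sum x' (insert b A)"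
      have qX': "q \<le> X'" using q x'b by simp
      have "surplus \<alpha> \<Lambda> C b q \<le> surplus \<alpha> \<Lambda> C b X'"
      proof (cases "X' = X")
        case True
        then show ?thesis using incr[OF top_le q(1)] qX' by (simp add: X_def)
      next
        case False
        have "X' \<in> insert X ((\<lambda>l. (\<tau> - C l) / \<sigma> l) ` P)" unfolding X'_def using finP by (intro Max_in) auto
        then obtain l where l: "l \<in> \<Lambda>" "\<sigma> l > 0" "X' = (\<tau> - C l) / \<sigma> l" using False by (auto simp: P_def)
        have "surplus \<alpha> \<Lambda> C b q \<le> \<sigma> l * q + C l" using surplus_le[OF \<Lambda>(1) l(1), of \<alpha> C b q] by (simp add: line)
        also have "\<dots> \<le> \<sigma> l * X' + C l" using l(2) qX' by (simp only: add_le_cancel_right mult_le_cancel_left_pos)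
        also have "\<dots> = \<tau>" using l by simp
        finally show ?thesis using X'\<tau> by simp
      qed
      moreover have "(1 + \<alpha>) * (w - b) * q \<le> (1 + \<alpha>) * (w - b) * X'"
        using w \<alpha> qX' by (intro mult_left_mono) auto
      ultimately show "surplus \<alpha> \<Lambda> C w q \<le> surplus \<alpha> \<Lambda> C w (sum x' (insert b A))"
        using surplus_shift[OF \<Lambda>, of \<alpha> C w _ b] x'b by simp
    qed
  qed
  then show ?thesis by (auto simp: J_def)
qed

section \<open>Consequences of the bilateral bound\<close>

definition truthful :: "real set \<Rightarrow> (real \<Rightarrow> real) \<Rightarrow> (real \<Rightarrow> real) \<Rightarrow> bool" where
  "truthful S X P \<longleftrightarrow> (\<forall>t\<in>S. \<forall>r\<in>S. 0 \<le> t * X t - P t \<and> t * X r - P r \<le> t * X t - P t)"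

text \<open>The value of \<open>\<beta>\<close> FB is approached on the bilateral instance with buyer value \<open>v\<close> and seller value
  \<open>b = -c\<close>; here \<open>e\<close> is the probability of trade and \<open>P\<close>, \<open>R\<close> are interim payments.\<close>

definition attainable :: "real \<Rightarrow> real \<Rightarrow> real pmf \<Rightarrow> real pmf \<Rightarrow> bool" where
  "attainable \<alpha> \<beta> F G \<longleftrightarrow> (\<forall>\<epsilon>>0. \<exists>e P R.
     (\<forall>v b. 0 \<le> e v b \<and> e v b \<le> (1::real)) \<and>
     truthful (set_pmf F) (\<lambda>v. \<Sum>b\<in>set_pmf G. pmf G b * e v b) P \<and>
     truthful (set_pmf G) (\<lambda>b. \<Sum>v\<in>set_pmf F. pmf F v * e v b) R \<and>
     \<beta> * (\<Sum>v\<in>set_pmf F. \<Sum>b\<in>set_pmf G. pmf F v * pmf G b * max 0 (v + b)) - \<epsilon> \<le>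
     (\<Sum>v\<in>set_pmf F. pmf F v * (v * (\<Sum>b\<in>set_pmf G. pmf G b * e v b) + \<alpha> * P v)) +
     (\<Sum>b\<in>set_pmf G. pmf G b * (b * (\<Sum>v\<in>set_pmf F. pmf F v * e v b) + \<alpha> * R b)))"

lemma finite_pmf_exists:
  assumes "finite S" "\<And>x. x \<in> S \<Longrightarrow> 0 < w x" "sum w S = (1::real)"
  shows "\<exists>p. set_pmf p = S \<and> (\<forall>x\<in>S. pmf p x = w x)"
proof -
  define g where "g x = (if x \<in> S then w x else 0)" for x
  have g0: "0 \<le> g x" for x using assms(2) by (auto simp: g_def less_imp_le)
  have "(\<integral>\<^sup>+ x. ennreal (g x) \<partial>count_space UNIV) = (\<Sum>x\<in>S. ennreal (g x))"
    using assms by (intro nn_integral_count_space') (auto simp: g_def)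
  also have "\<dots> = ennreal (\<Sum>x\<in>S. g x)" using g0 by simp
  also have "(\<Sum>x\<in>S. g x) = 1" using assms(3) by (simp add: g_def)
  finally have *: "pmf (embed_pmf g) x = g x" for x using g0 by (intro pmf_embed_pmf) auto
  then have "set_pmf (embed_pmf g) = S" using assms(2) by (force simp: set_pmf_eq g_def)
  then show ?thesis using * by (intro exI[of _ "embed_pmf g"]) (auto simp: g_def)
qed

section \<open>Truthful rules as mixtures of posted prices\<close>

lemma truthful_mono:
  assumes "truthful S X P"
  shows "mono_on S X"
proof (rule mono_onI)
  fix r t assume *: "r \<in> S" "t \<in> S" "r \<le> t"
  have "t * X r - P r \<le> t * X t - P t" "r * X t - P t \<le> r * X r - P r"
    using assms * by (auto simp: truthful_def)
  then have "(t - r) * X r \<le> (t - r) * X t" by (simp add: algebra_simps)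
  then show "X r \<le> X t" using *(3) by (cases "t = r") (auto simp: mult_le_cancel_left)
qed

text \<open>Incentive compatibility makes \<open>X\<close> monotone, hence a mixture of posted
  prices, and minimality of the rent bounds the payments. An objective with
  \<open>\<alpha> \<ge> 0\<close> can thus be estimated with \<open>price\<close> in place of
  unknown payments.\<close>

lemma truthful_thresholds:
  assumes "finite S" "truthful S X P" "\<And>t. t \<in> S \<Longrightarrow> 0 \<le> X t"
  shows "\<exists>d. (\<forall>s. 0 \<le> d s) \<and> (\<forall>t\<in>S. X t = quantity d S t \<and> P t \<le> price d S t)"
proof -
  obtain d where d: "\<And>s. 0 \<le> d s" "\<And>t. t \<in> S \<Longrightarrow> X t = quantity d S t"
    using threshold_decomposition[OF assms(1) truthful_mono[OF assms(2)] assms(3)] by auto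
  have "\<forall>t\<in>S. rent d S t \<le> t * X t - P t"
  proof (rule rent_minimal[OF assms(1) d])
    fix t r assume "t \<in> S" "r \<in> S"
    then have "t * X r - P r \<le> t * X t - P t" using assms(2) by (auto simp: truthful_def)
    then show "r * X r - P r + (t - r) * X r \<le> t * X t - P t" by (simp add: algebra_simps)
  qed (use assms d in \<open>auto simp: truthful_def\<close>)
  then have "\<forall>t\<in>S. P t \<le> price d S t" using d(2) by (simp add: rent_eq)
  then show ?thesis using d by blast
qed

text \<open>Moves thresholds from a smaller support to a larger one; the factor \<open>c\<close>
  will undo the normalization of a conditional distribution.\<close>

lemma quantity_extend:
  assumes "finite Vs" "S \<subseteq> Vs"
  shows "quantity (\<lambda>s. if s \<in> S then c * d s else 0) Vs v = c * quantity d S v"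
    "price (\<lambda>s. if s \<in> S then c * d s else 0) Vs v = c * price d S v"
    "rent (\<lambda>s. if s \<in> S then c * d s else 0) Vs v = c * rent d S v"
proof -
  have *: "(\<Sum>s\<in>{s\<in>Vs. s \<le> v}. (if s \<in> S then c * d s else 0) * k s) = c * (\<Sum>s\<in>{s\<in>S. s \<le> v}. d s * k s)" for k
    unfolding sum_distrib_left using assms finite_subset[OF assms(2,1)]
    by (intro sum.mono_neutral_cong_right) auto
  show "quantity (\<lambda>s. if s \<in> S then c * d s else 0) Vs v = c * quantity d S v"
    using *[of "\<lambda>_. 1"] by (simp add: quantity_def)
  show "price (\<lambda>s. if s \<in> S then c * d s else 0) Vs v = c * price d S v"
    using *[of "\<lambda>s. s"] by (simp add: price_def)
  show "rent (\<lambda>s. if s \<in> S then c * d s else 0) Vs v = c * rent d S v"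
    using *[of "\<lambda>s. v - s"] by (simp add: rent_def)
qed

text \<open>Thresholds inside an upper set sell nothing outside it, so after extension by zero the
  ironing inequality on \<open>B\<close> is one on \<open>T\<close>. Ironed values of the full
  distribution thereby serve for an agent conditioned on \<open>T\<close>.\<close>

lemma ironed_upper_tail:
  assumes "ironed \<alpha> p B h" "finite B" "T \<subseteq> B" and up: "\<And>t b. t \<in> T \<Longrightarrow> b \<in> B \<Longrightarrow> t \<le> b \<Longrightarrow> b \<in> T"
    and d: "\<And>s. 0 \<le> d s"
  shows "(\<Sum>t\<in>T. p t * (t * quantity d T t + \<alpha> * price d T t)) \<le> (\<Sum>t\<in>T. p t * (h t * quantity d T t))"
proof -
  define d' where "d' = (\<lambda>s. if s \<in> T then 1 * d s else 0)"
  have q: "quantity d' B t = quantity d T t" "price d' B t = price d T t" for t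
    using quantity_extend[OF assms(2,3), of 1 d t] by (simp_all add: d'_def)
  have z: "quantity d T t = 0" "price d T t = 0" if "t \<in> B - T" for t
  proof -
    have "{s\<in>T. s \<le> t} = {}" using up that by auto
    then show "quantity d T t = 0" "price d T t = 0" unfolding quantity_def price_def by (simp_all only: sum.empty)
  qed
  have "(\<Sum>t\<in>T. p t * (t * quantity d T t + \<alpha> * price d T t)) = (\<Sum>t\<in>B. p t * (t * quantity d T t + \<alpha> * price d T t))"
    using assms(2,3) z by (intro sum.mono_neutral_left) auto
  also have "\<dots> \<le> (\<Sum>t\<in>B. p t * (h t * quantity d T t))"
    using ironed_upper[OF assms(1,2), of d'] d unfolding q by (auto simp: d'_def)
  also have "\<dots> = (\<Sum>t\<in>T. p t * (h t * quantity d T t))"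
    using assms(2,3) z by (intro sum.mono_neutral_right) auto
  finally show ?thesis .
qed

text \<open>The bilateral instance behind this bound has a buyer distributed proportionally to \<open>f\<close> and the
  seller conditioned on values in \<open>T\<close>; ironing is done for the unconditioned seller, which is
  legitimate because \<open>T\<close> is an upper set.\<close>

lemma attainable_bound:
  fixes F G :: "real pmf" and f hb :: "real \<Rightarrow> real"
  assumes B: "finite B" "ironed \<alpha> g B hb" "\<And>b. b \<in> B \<Longrightarrow> 0 < g b"
    and T: "T \<subseteq> B" "T \<noteq> {}" and up: "\<And>t b. t \<in> T \<Longrightarrow> b \<in> B \<Longrightarrow> t \<le> b \<Longrightarrow> b \<in> T"
    and Vs: "finite Vs" and f: "\<And>v. v \<in> Vs \<Longrightarrow> 0 \<le> f v" and w: "w \<in> Vs" "f w = 1" "\<And>v. v \<in> Vs \<Longrightarrow> v \<le> w"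
    and \<alpha>: "\<alpha> \<ge> 0" and \<epsilon>: "\<epsilon> > 0"
    and att: "\<And>F G :: real pmf. finite (set_pmf F) \<Longrightarrow> finite (set_pmf G) \<Longrightarrow> attainable \<alpha> \<beta> F G"
    and \<Lambda>: "finite \<Lambda>" "\<Lambda> \<noteq> {}" and C: "\<And>l. C l = (\<Sum>b\<in>B. g b * max 0 (hb b - l))"
  shows "\<exists>d. (\<forall>s. 0 \<le> d s) \<and> quantity d Vs w \<le> sum g T \<and>
     \<beta> * (\<Sum>v\<in>Vs. f v * (\<Sum>b\<in>T. g b * max 0 (v + b))) - \<epsilon> \<le>
     (\<Sum>v\<in>Vs. f v * (surplus \<alpha> \<Lambda> C v (quantity d Vs v) - \<alpha> * rent d Vs v))"
proof -
  define S where "S = {v\<in>Vs. f v > 0}"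
  have S: "finite S" "S \<subseteq> Vs" "w \<in> S" using Vs w by (auto simp: S_def)
  have finT: "finite T" using T B finite_subset by blast
  define N where "N = sum f S"
  define \<Gamma> where "\<Gamma> = sum g T"
  have N: "N > 0" unfolding N_def using S by (intro sum_pos) (auto simp: S_def)
  have \<Gamma>: "\<Gamma> > 0" unfolding \<Gamma>_def using T B finT by (intro sum_pos) auto
  have "\<And>v. v \<in> S \<Longrightarrow> 0 < f v / N" using N by (simp add: S_def)
  moreover have "(\<Sum>v\<in>S. f v / N) = 1"
    unfolding sum_divide_distrib[symmetric] N_def[symmetric] using N by simp
  ultimately obtain F where F: "set_pmf F = S" "\<And>v. v \<in> S \<Longrightarrow> pmf F v = f v / N"
    using finite_pmf_exists[of S "\<lambda>v. f v / N"] S(1) by blast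
  have "\<And>b. b \<in> T \<Longrightarrow> 0 < g b / \<Gamma>" using \<Gamma> T B by auto
  moreover have "(\<Sum>b\<in>T. g b / \<Gamma>) = 1"
    unfolding sum_divide_distrib[symmetric] \<Gamma>_def[symmetric] using \<Gamma> by simp
  ultimately obtain G where G: "set_pmf G = T" "\<And>b. b \<in> T \<Longrightarrow> pmf G b = g b / \<Gamma>"
    using finite_pmf_exists[of T "\<lambda>b. g b / \<Gamma>"] finT by blast
  have "attainable \<alpha> \<beta> F G" using att[of F G] F G S finT by simp
  moreover have "\<epsilon> / (N * \<Gamma>) > 0" using \<epsilon> N \<Gamma> by simp
  ultimately obtain e P R where e: "\<And>v b. 0 \<le> e v b" "\<And>v b. e v b \<le> (1::real)"
    and ICv: "truthful S (\<lambda>v. \<Sum>b\<in>T. pmf G b * e v b) P"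
    and ICb: "truthful T (\<lambda>b. \<Sum>v\<in>S. pmf F v * e v b) R"
    and obj: "\<beta> * (\<Sum>v\<in>S. \<Sum>b\<in>T. pmf F v * pmf G b * max 0 (v + b)) - \<epsilon> / (N * \<Gamma>) \<le>
     (\<Sum>v\<in>S. pmf F v * (v * (\<Sum>b\<in>T. pmf G b * e v b) + \<alpha> * P v)) +
     (\<Sum>b\<in>T. pmf G b * (b * (\<Sum>v\<in>S. pmf F v * e v b) + \<alpha> * R b))"
    unfolding attainable_def F(1) G(1) by blast
  define X where "X v = (\<Sum>b\<in>T. pmf G b * e v b)" for v
  define Y where "Y b = (\<Sum>v\<in>S. pmf F v * e v b)" for b
  have X0: "0 \<le> X v" and Y0: "0 \<le> Y b" for v b
    unfolding X_def Y_def by (auto intro!: sum_nonneg mult_nonneg_nonneg e(1))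
  obtain d where d: "\<And>s. 0 \<le> d s" "\<And>v. v \<in> S \<Longrightarrow> X v = quantity d S v" "\<And>v. v \<in> S \<Longrightarrow> P v \<le> price d S v"
    using truthful_thresholds[OF S(1) ICv[folded X_def] X0] by blast
  obtain k where k: "\<And>s. 0 \<le> k s" "\<And>b. b \<in> T \<Longrightarrow> Y b = quantity k T b" "\<And>b. b \<in> T \<Longrightarrow> R b \<le> price k T b"
    using truthful_thresholds[OF finT ICb[folded Y_def] Y0] by blast
  \<comment> \<open>Conditioning the seller on \<open>T\<close> divided the weights \<open>g\<close>
    by \<open>\<Gamma>\<close>. Multiplying back expresses quantities in terms of \<open>g\<close>,
    so that the capacity is the mass of \<open>T\<close>.\<close>
  define D where "D = (\<lambda>s. if s \<in> S then \<Gamma> * d s else 0)"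
  have qD: "quantity D Vs v = \<Gamma> * quantity d S v" "rent D Vs v = \<Gamma> * rent d S v" for v
    using quantity_extend[OF Vs S(2), of \<Gamma> d v] by (simp_all add: D_def)
  have X1: "X v \<le> 1" for v
  proof -
    have "X v \<le> (\<Sum>b\<in>T. pmf G b)" unfolding X_def using e by (intro sum_mono) (simp add: mult_left_le)
    also have "\<dots> = 1" using sum_pmf_eq_1[of T G] finT G by simp
    finally show ?thesis .
  qed
  have GX: "\<Gamma> * X v = (\<Sum>b\<in>T. g b * e v b)" for v
    unfolding X_def sum_distrib_left using G \<Gamma> by (intro sum.cong) auto
  have NY: "N * Y b = (\<Sum>v\<in>S. f v * e v b)" for b
    unfolding Y_def sum_distrib_left using F N by (intro sum.cong) auto
  have buyer: "\<Gamma> * (v * X v + \<alpha> * P v) \<le> (1 + \<alpha>) * v * quantity D Vs v - \<alpha> * rent D Vs v" if "v \<in> S" for v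
  proof -
    have "v * X v + \<alpha> * P v \<le> v * X v + \<alpha> * price d S v" using d(3)[OF that] \<alpha> by (simp add: mult_left_mono)
    then have "\<Gamma> * (v * X v + \<alpha> * P v) \<le> \<Gamma> * (v * X v + \<alpha> * price d S v)"
      using \<Gamma> by (intro mult_left_mono) auto
    also have "\<dots> = (1 + \<alpha>) * v * quantity D Vs v - \<alpha> * rent D Vs v"
      unfolding qD d(2)[OF that] by (simp add: rent_eq algebra_simps)
    finally show ?thesis .
  qed
  have "(\<Sum>b\<in>T. g b * (b * Y b + \<alpha> * R b)) \<le> (\<Sum>b\<in>T. g b * (b * quantity k T b + \<alpha> * price k T b))"
  proof (intro sum_mono)
    fix b assume b: "b \<in> T"
    then have "0 < g b" using T B by auto
    moreover have "b * Y b + \<alpha> * R b \<le> b * quantity k T b + \<alpha> * price k T b"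
      using k(2)[OF b] mult_left_mono[OF k(3)[OF b] \<alpha>] by simp
    ultimately show "g b * (b * Y b + \<alpha> * R b) \<le> g b * (b * quantity k T b + \<alpha> * price k T b)"
      by (intro mult_left_mono) auto
  qed
  also have "\<dots> \<le> (\<Sum>b\<in>T. g b * (hb b * Y b))"
    using ironed_upper_tail[OF B(2,1) T(1) up k(1)] k(2) by simp
  finally have "N * (\<Sum>b\<in>T. g b * (b * Y b + \<alpha> * R b)) \<le> N * (\<Sum>b\<in>T. g b * (hb b * Y b))"
    using N by (intro mult_left_mono) auto
  also have "\<dots> = (\<Sum>b\<in>T. g b * hb b * (N * Y b))"
    unfolding sum_distrib_left by (intro sum.cong) auto
  also have "\<dots> = (\<Sum>b\<in>T. \<Sum>v\<in>S. f v * (g b * hb b * e v b))"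
    unfolding NY sum_distrib_left by (intro sum.cong) auto
  also have "\<dots> = (\<Sum>v\<in>S. f v * (\<Sum>b\<in>T. g b * hb b * e v b))"
    unfolding sum_distrib_left by (rule sum.swap)
  finally have seller: "N * (\<Sum>b\<in>T. g b * (b * Y b + \<alpha> * R b)) \<le> (\<Sum>v\<in>S. f v * (\<Sum>b\<in>T. g b * hb b * e v b))" .
  \<comment> \<open>Weak duality: with \<open>l\<close> as price for the total quantity, each seller
    value contributes at most its positive part above \<open>l\<close>. Passing from
    \<open>T\<close> to \<open>B\<close> adds nonnegative terms only, so one function
    \<open>C\<close> serves all sections.\<close>
  have dual: "(1 + \<alpha>) * v * quantity D Vs v + (\<Sum>b\<in>T. g b * hb b * e v b) \<le> surplus \<alpha> \<Lambda> C v (quantity D Vs v)"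
    if v: "v \<in> S" for v
    unfolding le_surplus[OF \<Lambda>]
  proof
    fix l assume "l \<in> \<Lambda>"
    have "(\<Sum>b\<in>T. g b * hb b * e v b) = (\<Sum>b\<in>T. g b * (hb b - l) * e v b) + l * (\<Gamma> * X v)"
      unfolding GX sum_distrib_left sum.distrib[symmetric] by (intro sum.cong) (auto simp: algebra_simps)
    also have "(\<Sum>b\<in>T. g b * (hb b - l) * e v b) \<le> (\<Sum>b\<in>T. g b * max 0 (hb b - l))"
    proof (intro sum_mono)
      fix b assume "b \<in> T"
      then have "0 < g b" using T B by auto
      have "(hb b - l) * e v b \<le> max 0 (hb b - l) * e v b" using e by (intro mult_right_mono) auto
      also have "\<dots> \<le> max 0 (hb b - l) * 1" using e by (intro mult_left_mono) auto
      finally show "g b * (hb b - l) * e v b \<le> g b * max 0 (hb b - l)" using \<open>0 < g b\<close> by (simp add: mult.assoc)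
    qed
    also have "\<dots> \<le> C l" unfolding C using B T by (intro sum_mono2) (auto simp: less_imp_le)
    finally show "(1 + \<alpha>) * v * quantity D Vs v + (\<Sum>b\<in>T. g b * hb b * e v b) \<le>
        (1 + \<alpha>) * v * quantity D Vs v + l * quantity D Vs v + C l"
      using qD(1)[of v] d(2)[OF v] by simp
  qed
  have sumS: "(\<Sum>v\<in>Vs. f v * z v) = (\<Sum>v\<in>S. f v * z v)" for z :: "real \<Rightarrow> real"
    using Vs f by (intro sum.mono_neutral_right) (force simp: S_def)+
  have "N * \<Gamma> * (\<beta> * (\<Sum>v\<in>S. \<Sum>b\<in>T. pmf F v * pmf G b * max 0 (v + b)) - \<epsilon> / (N * \<Gamma>)) \<le>
     N * \<Gamma> * ((\<Sum>v\<in>S. pmf F v * (v * X v + \<alpha> * P v)) + (\<Sum>b\<in>T. pmf G b * (b * Y b + \<alpha> * R b)))"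
    using obj N \<Gamma> unfolding X_def Y_def by (intro mult_left_mono) auto
  also have "N * \<Gamma> * (\<beta> * (\<Sum>v\<in>S. \<Sum>b\<in>T. pmf F v * pmf G b * max 0 (v + b)) - \<epsilon> / (N * \<Gamma>)) =
     \<beta> * (N * \<Gamma> * (\<Sum>v\<in>S. \<Sum>b\<in>T. pmf F v * pmf G b * max 0 (v + b))) - \<epsilon>"
    using N \<Gamma> by (simp add: right_diff_distrib)
  also have "N * \<Gamma> * (\<Sum>v\<in>S. \<Sum>b\<in>T. pmf F v * pmf G b * max 0 (v + b)) =
     (\<Sum>v\<in>S. f v * (\<Sum>b\<in>T. g b * max 0 (v + b)))"
    unfolding sum_distrib_left using F G N \<Gamma> by (intro sum.cong) auto
  also have "N * \<Gamma> * ((\<Sum>v\<in>S. pmf F v * (v * X v + \<alpha> * P v)) + (\<Sum>b\<in>T. pmf G b * (b * Y b + \<alpha> * R b))) =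
     (\<Sum>v\<in>S. f v * (\<Gamma> * (v * X v + \<alpha> * P v))) + N * (\<Sum>b\<in>T. g b * (b * Y b + \<alpha> * R b))"
  proof -
    have "N * \<Gamma> * (\<Sum>v\<in>S. pmf F v * (v * X v + \<alpha> * P v)) = (\<Sum>v\<in>S. f v * (\<Gamma> * (v * X v + \<alpha> * P v)))"
      unfolding sum_distrib_left using F N by (intro sum.cong) auto
    moreover have "\<Gamma> * (\<Sum>b\<in>T. pmf G b * (b * Y b + \<alpha> * R b)) = (\<Sum>b\<in>T. g b * (b * Y b + \<alpha> * R b))"
      unfolding sum_distrib_left using G \<Gamma> by (intro sum.cong) auto
    ultimately show ?thesis by (simp add: distrib_left mult.assoc)
  qed
  also have "\<dots> \<le> (\<Sum>v\<in>S. f v * ((1 + \<alpha>) * v * quantity D Vs v - \<alpha> * rent D Vs v)) +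
      (\<Sum>v\<in>S. f v * (\<Sum>b\<in>T. g b * hb b * e v b))"
    using buyer seller by (intro add_mono sum_mono mult_left_mono) (auto simp: S_def)
  also have "\<dots> = (\<Sum>v\<in>S. f v * ((1 + \<alpha>) * v * quantity D Vs v + (\<Sum>b\<in>T. g b * hb b * e v b) - \<alpha> * rent D Vs v))"
    unfolding sum.distrib[symmetric] by (intro sum.cong) (auto simp: algebra_simps)
  also have "\<dots> \<le> (\<Sum>v\<in>S. f v * (surplus \<alpha> \<Lambda> C v (quantity D Vs v) - \<alpha> * rent D Vs v))"
    using dual by (intro sum_mono mult_left_mono) (auto simp: S_def)
  finally have fin: "\<beta> * (\<Sum>v\<in>S. f v * (\<Sum>b\<in>T. g b * max 0 (v + b))) - \<epsilon> \<le>
     (\<Sum>v\<in>S. f v * (surplus \<alpha> \<Lambda> C v (quantity D Vs v) - \<alpha> * rent D Vs v))" .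
  show ?thesis
  proof (intro exI[of _ D] conjI allI)
    fix s show "0 \<le> D s" using d \<Gamma> by (simp add: D_def)
  next
    have "quantity D Vs w = \<Gamma> * X w" using qD d(2)[OF S(3)] by simp
    then show "quantity D Vs w \<le> sum g T" using X1[of w] \<Gamma> unfolding \<Gamma>_def[symmetric] by (simp add: mult_left_le)
  next
    show "\<beta> * (\<Sum>v\<in>Vs. f v * (\<Sum>b\<in>T. g b * max 0 (v + b))) - \<epsilon> \<le>
     (\<Sum>v\<in>Vs. f v * (surplus \<alpha> \<Lambda> C v (quantity D Vs v) - \<alpha> * rent D Vs v))"
      unfolding sumS by (rule fin)
  qed
qed

text \<open>The region \<open>R\<close> on which an edge belongs to the first best (the other types being fixed) need not be
  a rectangle, since it may require \<open>v + b\<close> to exceed a positive opportunity cost.\<close>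

lemma edge_inequality:
  fixes F G :: "real pmf"
  assumes fin: "finite (set_pmf F)" "finite (set_pmf G)" and \<alpha>: "\<alpha> \<ge> 0" and \<beta>: "\<beta> \<ge> 0"
    and hv: "ironed \<alpha> (pmf F) (set_pmf F) hv" and hb: "ironed \<alpha> (pmf G) (set_pmf G) hb"
    and att: "\<And>F G :: real pmf. finite (set_pmf F) \<Longrightarrow> finite (set_pmf G) \<Longrightarrow> attainable \<alpha> \<beta> F G"
    and nonneg: "\<And>v b. v \<in> set_pmf F \<Longrightarrow> b \<in> set_pmf G \<Longrightarrow> R v b \<Longrightarrow> 0 \<le> v + b"
    and upper: "\<And>v b v' b'. v' \<in> set_pmf F \<Longrightarrow> b' \<in> set_pmf G \<Longrightarrow> R v b \<Longrightarrow> v \<le> v' \<Longrightarrow> b \<le> b' \<Longrightarrow> R v' b'"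
  shows "\<beta> * (\<Sum>v\<in>set_pmf F. pmf F v * (\<Sum>b\<in>{b\<in>set_pmf G. R v b}. pmf G b * (v + b)))
    \<le> (\<Sum>v\<in>set_pmf F. pmf F v * (\<Sum>b\<in>{b\<in>set_pmf G. R v b}. pmf G b * max 0 (hv v + hb b)))"
proof -
  define Vs where "Vs = set_pmf F"
  define B where "B = set_pmf G"
  define T where "T v = {b\<in>B. R v b}" for v
  define \<Gamma> where "\<Gamma> v = sum (pmf G) (T v)" for v
  define \<kappa> where "\<kappa> v = \<beta> * (\<Sum>b\<in>T v. pmf G b * (v + b))" for v
  \<comment> \<open>Finitely many multipliers suffice: the optimal cutoff for seller values is
    either an ironed seller value or the point where the sum with \<open>hv v\<close> changes
    sign.\<close>
  define \<Lambda> where "\<Lambda> = hb ` B \<union> (\<lambda>v. - hv v) ` Vs"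
  define C where "C l = (\<Sum>b\<in>B. pmf G b * max 0 (hb b - l))" for l
  have finV: "finite Vs" "finite B" and ne: "Vs \<noteq> {}" "B \<noteq> {}"
    using fin set_pmf_not_empty by (auto simp: Vs_def B_def)
  have finT: "finite (T v)" for v using finV by (simp add: T_def)
  have \<Lambda>: "finite \<Lambda>" "\<Lambda> \<noteq> {}" using finV ne by (auto simp: \<Lambda>_def)
  have Tmono: "T v \<subseteq> T w" if "w \<in> Vs" "v \<le> w" for v w
    using upper[of w _ v] that by (auto simp: T_def Vs_def B_def)
  have Tup: "b' \<in> T v" if "v \<in> Vs" "b \<in> T v" "b' \<in> B" "b \<le> b'" for v b b'
    using upper[of v b' v b] that by (auto simp: T_def Vs_def B_def)
  have C0: "0 \<le> C l" for l unfolding C_def by (intro sum_nonneg) auto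
  have "\<exists>x. (\<forall>s. 0 \<le> x s) \<and>
    (\<forall>v\<in>Vs. quantity x Vs v \<le> \<Gamma> v \<and> \<kappa> v \<le> surplus \<alpha> \<Lambda> C v (quantity x Vs v) - \<alpha> * rent x Vs v)"
  proof (rule exists_cheapest_thresholds[OF \<Lambda> \<alpha> finV(1)])
    fix v w assume "v \<in> Vs" "w \<in> Vs" "v \<le> w"
    then show "\<Gamma> v \<le> \<Gamma> w" unfolding \<Gamma>_def using Tmono finT by (intro sum_mono2) auto
  next
    fix v show "0 \<le> \<Gamma> v" unfolding \<Gamma>_def by (intro sum_nonneg) auto
  next
    fix w :: real and f :: "real \<Rightarrow> real" and \<epsilon> :: real
    assume w: "w \<in> Vs" and f: "\<forall>v. 0 \<le> f v" "f w = 1" and \<epsilon>: "\<epsilon> > 0"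
    show "\<exists>d. (\<forall>s. 0 \<le> d s) \<and> quantity d Vs w \<le> \<Gamma> w \<and>
        - \<epsilon> \<le> (\<Sum>v\<in>{v\<in>Vs. v \<le> w}. f v * (surplus \<alpha> \<Lambda> C v (quantity d Vs v) - \<alpha> * rent d Vs v - \<kappa> v))"
    proof (cases "T w = {}")
      case True
      have "0 \<le> (\<Sum>v\<in>{v\<in>Vs. v \<le> w}. f v * (surplus \<alpha> \<Lambda> C v 0 - \<kappa> v))"
      proof (intro sum_nonneg mult_nonneg_nonneg)
        fix v assume "v \<in> {v\<in>Vs. v \<le> w}"
        then have "T v = {}" using Tmono[OF w, of v] True by auto
        then have "\<kappa> v = 0" unfolding \<kappa>_def by (simp only: sum.empty)
        moreover have "0 \<le> surplus \<alpha> \<Lambda> C v 0" using C0 by (simp add: le_surplus[OF \<Lambda>])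
        ultimately show "0 \<le> surplus \<alpha> \<Lambda> C v 0 - \<kappa> v" by simp
      qed (use f in auto)
      moreover have "0 \<le> \<Gamma> w" unfolding \<Gamma>_def by (intro sum_nonneg) auto
      ultimately show ?thesis using \<epsilon>
        by (intro exI[of _ "\<lambda>_. 0"]) (auto simp: quantity_def rent_def)
    next
      case False
      define V' where "V' = {v\<in>Vs. v \<le> w}"
      have V': "finite V'" "V' \<subseteq> Vs" "w \<in> V'" using finV w by (auto simp: V'_def)
      have "\<exists>d. (\<forall>s. 0 \<le> d s) \<and> quantity d V' w \<le> sum (pmf G) (T w) \<and>
        \<beta> * (\<Sum>v\<in>V'. f v * (\<Sum>b\<in>T w. pmf G b * max 0 (v + b))) - \<epsilon> \<le>
          (\<Sum>v\<in>V'. f v * (surplus \<alpha> \<Lambda> C v (quantity d V' v) - \<alpha> * rent d V' v))"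
      proof (rule attainable_bound[where B = B and hb = hb])
        show "ironed \<alpha> (pmf G) B hb" using hb by (simp add: B_def)
        show "0 < pmf G b" if "b \<in> B" for b using that by (simp add: B_def pmf_positive_iff)
        show "T w \<subseteq> B" by (auto simp: T_def)
        show "b \<in> T w" if "t \<in> T w" "b \<in> B" "t \<le> b" for t b using Tup[OF w that] .
        show "0 \<le> f v" for v using f by blast
        show "v \<le> w" if "v \<in> V'" for v using that by (simp add: V'_def)
      qed (fact finV(2) False V'(1) V'(3) f(2) \<alpha> \<epsilon> att \<Lambda> C_def)+
      then obtain d where d: "\<forall>s. 0 \<le> d s" "quantity d V' w \<le> \<Gamma> w"
        "\<beta> * (\<Sum>v\<in>V'. f v * (\<Sum>b\<in>T w. pmf G b * max 0 (v + b))) - \<epsilon> \<le>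
          (\<Sum>v\<in>V'. f v * (surplus \<alpha> \<Lambda> C v (quantity d V' v) - \<alpha> * rent d V' v))"
        unfolding \<Gamma>_def by blast
      have same: "quantity d Vs v = quantity d V' v" "rent d Vs v = rent d V' v" if "v \<le> w" for v
        using that unfolding quantity_def rent_def V'_def by (auto intro!: sum.cong)
      \<comment> \<open>The part of the region below \<open>w\<close> is enlarged to a rectangle.
        Taking positive parts makes the added cells harmless, so the demand \<open>\<kappa>\<close>
        stays below the bilateral benchmark.\<close>
      have "\<kappa> v \<le> \<beta> * (\<Sum>b\<in>T w. pmf G b * max 0 (v + b))" if "v \<in> V'" for v
      proof -
        have "(\<Sum>b\<in>T v. pmf G b * (v + b)) \<le> (\<Sum>b\<in>T v. pmf G b * max 0 (v + b))"
          by (intro sum_mono mult_left_mono) auto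
        also have "\<dots> \<le> (\<Sum>b\<in>T w. pmf G b * max 0 (v + b))"
          using Tmono[OF w, of v] that finT by (intro sum_mono2) (auto simp: V'_def)
        finally show ?thesis unfolding \<kappa>_def using \<beta> by (intro mult_left_mono) auto
      qed
      then have "(\<Sum>v\<in>V'. f v * \<kappa> v) \<le> (\<Sum>v\<in>V'. f v * (\<beta> * (\<Sum>b\<in>T w. pmf G b * max 0 (v + b))))"
        using f by (intro sum_mono mult_left_mono) auto
      also have "\<dots> = \<beta> * (\<Sum>v\<in>V'. f v * (\<Sum>b\<in>T w. pmf G b * max 0 (v + b)))"
        unfolding sum_distrib_left by (intro sum.cong) (auto simp: ac_simps)
      finally have "- \<epsilon> \<le> (\<Sum>v\<in>V'. f v * (surplus \<alpha> \<Lambda> C v (quantity d V' v) - \<alpha> * rent d V' v)) - (\<Sum>v\<in>V'. f v * \<kappa> v)"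
        using d(3) by linarith
      also have "\<dots> = (\<Sum>v\<in>V'. f v * (surplus \<alpha> \<Lambda> C v (quantity d Vs v) - \<alpha> * rent d Vs v - \<kappa> v))"
        unfolding sum_subtractf[symmetric] using same by (intro sum.cong) (auto simp: V'_def algebra_simps)
      finally show ?thesis using d same[of w] by (intro exI[of _ d]) (auto simp: V'_def)
    qed
  qed
  then obtain x where x: "\<And>s. 0 \<le> x s" "\<And>v. v \<in> Vs \<Longrightarrow> quantity x Vs v \<le> \<Gamma> v"
    "\<And>v. v \<in> Vs \<Longrightarrow> \<kappa> v \<le> surplus \<alpha> \<Lambda> C v (quantity x Vs v) - \<alpha> * rent x Vs v" by blast
  \<comment> \<open>Any quantity within capacity is worth no more than serving all seller values of
    the section with a positive ironed sum. Since \<open>surplus\<close> is a minimum of lines, one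
    suitable \<open>l\<close> proves this for each shape of the section.\<close>
  have pointwise: "hv v * quantity x Vs v + surplus \<alpha> \<Lambda> C 0 (quantity x Vs v) \<le> (\<Sum>b\<in>T v. pmf G b * max 0 (hv v + hb b))"
    if v: "v \<in> Vs" for v
  proof -
    define q where "q = quantity x Vs v"
    have q: "0 \<le> q" "q \<le> \<Gamma> v" using x v by (auto simp: q_def quantity_nonneg)
    have line: "surplus \<alpha> \<Lambda> C 0 q \<le> l * q + C l" if "l \<in> \<Lambda>" for l
      using surplus_le[OF \<Lambda>(1) that, of \<alpha> C 0 q] by simp
    have hbm: "hb b \<le> hb b'" if "b \<in> B" "b' \<in> B" "b \<le> b'" for b b'
      using hb that by (auto simp: ironed_def mono_on_def B_def)
    show ?thesis
    proof (cases "T v = {}")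
      case True
      then have "q = 0" using q by (simp add: \<Gamma>_def)
      define m where "m = Max B"
      have m: "m \<in> B" "\<And>b. b \<in> B \<Longrightarrow> b \<le> m" using finV ne by (auto simp: m_def)
      then have "hb b \<le> hb m" if "b \<in> B" for b using hbm that by auto
      then have "C (hb m) = 0" unfolding C_def by (intro sum.neutral) auto
      then show ?thesis using line[of "hb m"] m \<open>q = 0\<close> True by (simp add: q_def[symmetric] \<Lambda>_def)
    next
      case False
      define m where "m = Min (T v)"
      have m: "m \<in> T v" "\<And>b. b \<in> T v \<Longrightarrow> m \<le> b" using False finT[of v] by (auto simp: m_def)
      have mB: "m \<in> B" using m by (auto simp: T_def)
      have below: "hb b \<le> hb m" if "b \<in> B - T v" for b
        using hbm[of b m] that mB Tup[OF v m(1), of b] by force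
      show ?thesis
      proof (cases "hb m \<le> - hv v")
        case True
        \<comment> \<open>The cutoff lies inside the section: values outside have ironed value at
          most \<open>hb m\<close>, hence at most \<open>- hv v\<close>, and drop out of
          \<open>C\<close>. The terms in \<open>q\<close> cancel.\<close>
        have "C (- hv v) = (\<Sum>b\<in>T v. pmf G b * max 0 (hv v + hb b))"
          unfolding C_def using finV True below
          by (intro sum.mono_neutral_cong_right) (force simp: T_def add.commute)+
        then show ?thesis using line[of "- hv v"] v by (simp add: q_def[symmetric] \<Lambda>_def)
      next
        case False
        \<comment> \<open>The whole section is worth serving. With its lowest ironed value as
          multiplier, the coefficient of \<open>q\<close> is positive, and here the capacity
          \<open>\<Gamma> v\<close> limits the quantity.\<close>
        have "C (hb m) = (\<Sum>b\<in>T v. pmf G b * (hb b - hb m))"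
          unfolding C_def
        proof (intro sum.mono_neutral_cong_right)
          show "\<forall>b\<in>B - T v. pmf G b * max 0 (hb b - hb m) = 0" using below by force
          show "pmf G b * max 0 (hb b - hb m) = pmf G b * (hb b - hb m)" if "b \<in> T v" for b
            using hbm[of m b] m that mB by (auto simp: T_def)
        qed (use finV in \<open>auto simp: T_def\<close>)
        also have "\<dots> = (\<Sum>b\<in>T v. pmf G b * hb b) - hb m * \<Gamma> v"
          unfolding \<Gamma>_def sum_distrib_left sum_subtractf[symmetric] by (intro sum.cong) (auto simp: algebra_simps)
        finally have C: "C (hb m) = (\<Sum>b\<in>T v. pmf G b * hb b) - hb m * \<Gamma> v" .
        have "(\<Sum>b\<in>T v. pmf G b * max 0 (hv v + hb b)) = (\<Sum>b\<in>T v. pmf G b * (hv v + hb b))"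
        proof (intro sum.cong refl)
          fix b assume "b \<in> T v"
          then have "hb m \<le> hb b" using hbm[of m b] m mB by (auto simp: T_def)
          then show "pmf G b * max 0 (hv v + hb b) = pmf G b * (hv v + hb b)" using False by simp
        qed
        also have "\<dots> = hv v * \<Gamma> v + (\<Sum>b\<in>T v. pmf G b * hb b)"
          unfolding \<Gamma>_def sum_distrib_left sum.distrib[symmetric] by (intro sum.cong) (auto simp: algebra_simps)
        finally have *: "(\<Sum>b\<in>T v. pmf G b * max 0 (hv v + hb b)) = hv v * \<Gamma> v + (\<Sum>b\<in>T v. pmf G b * hb b)" .
        have "(hv v + hb m) * q \<le> (hv v + hb m) * \<Gamma> v" using False q by (intro mult_left_mono) auto
        moreover have "surplus \<alpha> \<Lambda> C 0 q \<le> hb m * q + C (hb m)" using mB by (intro line) (auto simp: \<Lambda>_def)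
        ultimately show ?thesis unfolding * C q_def[symmetric] by (simp add: algebra_simps)
      qed
    qed
  qed
  have "\<beta> * (\<Sum>v\<in>Vs. pmf F v * (\<Sum>b\<in>T v. pmf G b * (v + b))) = (\<Sum>v\<in>Vs. pmf F v * \<kappa> v)"
    unfolding \<kappa>_def sum_distrib_left by (intro sum.cong) (auto simp: ac_simps)
  also have "\<dots> \<le> (\<Sum>v\<in>Vs. pmf F v * (surplus \<alpha> \<Lambda> C v (quantity x Vs v) - \<alpha> * rent x Vs v))"
    using x(3) by (intro sum_mono mult_left_mono) auto
  also have "\<dots> = (\<Sum>v\<in>Vs. pmf F v * (v * quantity x Vs v + \<alpha> * price x Vs v)) + (\<Sum>v\<in>Vs. pmf F v * surplus \<alpha> \<Lambda> C 0 (quantity x Vs v))"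
  proof -
    have "surplus \<alpha> \<Lambda> C v q - \<alpha> * rent x Vs v = (v * q + \<alpha> * price x Vs v) + surplus \<alpha> \<Lambda> C 0 q"
      if "q = quantity x Vs v" for v q
      using surplus_shift[OF \<Lambda>, of \<alpha> C v q 0] that by (simp add: rent_eq algebra_simps)
    then show ?thesis by (simp add: distrib_left sum.distrib)
  qed
  \<comment> \<open>The thresholds \<open>x\<close> were chosen without reference to the weights of
    \<open>F\<close>; averaging against \<open>F\<close> itself is what permits ironing the
    buyer.\<close>
  also have "\<dots> \<le> (\<Sum>v\<in>Vs. pmf F v * (hv v * quantity x Vs v)) + (\<Sum>v\<in>Vs. pmf F v * surplus \<alpha> \<Lambda> C 0 (quantity x Vs v))"
    using ironed_upper[of \<alpha> "pmf F" Vs hv x] hv finV x by (simp add: Vs_def)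
  also have "\<dots> = (\<Sum>v\<in>Vs. pmf F v * (hv v * quantity x Vs v + surplus \<alpha> \<Lambda> C 0 (quantity x Vs v)))"
    by (simp add: distrib_left sum.distrib)
  also have "\<dots> \<le> (\<Sum>v\<in>Vs. pmf F v * (\<Sum>b\<in>T v. pmf G b * max 0 (hv v + hb b)))"
    using pointwise by (intro sum_mono mult_left_mono) auto
  finally show ?thesis by (simp add: Vs_def T_def B_def)
qed

section \<open>Interim form of a mechanism\<close>

lemma expectation_Pi_pmf_split:
  fixes \<phi> :: "('a \<Rightarrow> real) \<Rightarrow> real"
  assumes "finite A" "a \<in> A" "\<And>b. b \<in> A \<Longrightarrow> finite (set_pmf (p b))"
  shows "measure_pmf.expectation (Pi_pmf A d p) \<phi> =
    (\<Sum>t\<in>set_pmf (p a). pmf (p a) t * measure_pmf.expectation (Pi_pmf (A - {a}) d p) (\<lambda>\<theta>. \<phi> (\<theta>(a := t))))"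
proof -
  have A: "A = insert a (A - {a})" using assms(2) by auto
  have fin: "finite (set_pmf (Pi_pmf (A - {a}) d p))"
    using assms by (subst set_Pi_pmf) (auto intro!: finite_PiE_dflt)
  have "Pi_pmf A d p = bind_pmf (p a) (\<lambda>t. map_pmf (\<lambda>\<theta>. \<theta>(a := t)) (Pi_pmf (A - {a}) d p))"
    using assms Pi_pmf_insert'[of "A - {a}" a d p] by (subst A) (simp add: map_pmf_def)
  then have "measure_pmf.expectation (Pi_pmf A d p) \<phi> = (\<Sum>t\<in>set_pmf (p a). pmf (p a) t *\<^sub>R
      measure_pmf.expectation (map_pmf (\<lambda>\<theta>. \<theta>(a := t)) (Pi_pmf (A - {a}) d p)) \<phi>)"
    using assms fin by (simp only:) (rule pmf_expectation_bind; auto)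
  then show ?thesis by simp
qed

lemma finite_set_Pi_pmf:
  "finite A \<Longrightarrow> (\<And>b. b \<in> A \<Longrightarrow> finite (set_pmf (p b))) \<Longrightarrow> finite (set_pmf (Pi_pmf A d p))"
  by (subst set_Pi_pmf) (auto intro!: finite_PiE_dflt)

lemma sum_map_pmf_inj:
  fixes \<phi> :: "'b \<Rightarrow> real"
  assumes "inj f"
  shows "(\<Sum>c\<in>set_pmf (map_pmf f G). pmf (map_pmf f G) c * \<phi> c) = (\<Sum>b\<in>set_pmf G. pmf G b * \<phi> (f b))"
proof -
  have "inj_on f (set_pmf G)" using assms by (auto intro: inj_on_subset)
  then show ?thesis using assms by (simp add: sum.reindex pmf_map_inj')
qed

definition val :: "'a market \<Rightarrow> 'a \<Rightarrow> real \<Rightarrow> real" where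
  "val I a t = (if a \<in> buyers I then t else - t)"

definition served :: "'a market \<Rightarrow> 'a mechanism \<Rightarrow> 'a \<Rightarrow> ('a \<Rightarrow> real) \<Rightarrow> real" where
  "served I M a \<theta> = (if a \<in> buyers I then \<Sum>j\<in>sellers I. edge_prob M \<theta> a j
     else \<Sum>i\<in>buyers I. edge_prob M \<theta> i a)"

definition interim_alloc :: "'a market \<Rightarrow> 'a mechanism \<Rightarrow> 'a \<Rightarrow> real \<Rightarrow> real" where
  "interim_alloc I M a r = measure_pmf.expectation (prior_others I a) (\<lambda>\<theta>. served I M a (\<theta>(a := r)))"

definition interim_pay :: "'a market \<Rightarrow> 'a mechanism \<Rightarrow> 'a \<Rightarrow> real \<Rightarrow> real" where
  "interim_pay I M a r = measure_pmf.expectation (prior_others I a) (\<lambda>\<theta>. payment M (\<theta>(a := r)) a)"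

lemma val_val [simp]: "val I a (val I a t) = t"
  by (simp add: val_def)

lemma inj_val: "inj (val I a)"
  by (auto simp: inj_def val_def)

lemma marketD:
  assumes "matching_market I"
  shows "finite (agents I)" "finite (buyers I)" "finite (sellers I)" "buyers I \<inter> sellers I = {}"
    "edges I \<subseteq> buyers I \<times> sellers I" "feasible I \<noteq> {}"
    "\<And>M. M \<in> feasible I \<Longrightarrow> matching (edges I) M"
    "\<And>M M'. M \<in> feasible I \<Longrightarrow> M' \<subseteq> M \<Longrightarrow> M' \<in> feasible I"
    "\<And>a. a \<in> agents I \<Longrightarrow> finite (set_pmf (type_dist I a))"
    "finite (edges I)" "finite (feasible I)"
proof -
  show fe: "finite (edges I)"
    using assms unfolding matching_market_def by (meson finite_SigmaI finite_subset)
  have "feasible I \<subseteq> Pow (edges I)" using assms by (auto simp: matching_market_def matching_def)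
  then show "finite (feasible I)" using fe by (meson finite_Pow_iff finite_subset)
  show "finite (agents I)" using assms by (simp add: matching_market_def agents_def)
qed (use assms[unfolded matching_market_def] in \<open>blast+\<close>)

lemma finite_prior:
  assumes "matching_market I"
  shows "finite (set_pmf (prior I))" "finite (set_pmf (prior_others I a))"
  unfolding prior_def prior_others_def
  by (intro finite_set_Pi_pmf; use marketD[OF assms] in auto)+

lemma set_prior:
  assumes "matching_market I"
  shows "set_pmf (prior I) = profiles I"
  unfolding prior_def profiles_def using marketD[OF assms] by (simp add: set_Pi_pmf comp_def)

lemma prior_split:
  fixes \<phi> :: "('a \<Rightarrow> real) \<Rightarrow> real"
  assumes "matching_market I" "a \<in> agents I"
  shows "measure_pmf.expectation (prior I) \<phi> = (\<Sum>t\<in>set_pmf (type_dist I a). pmf (type_dist I a) t *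
     measure_pmf.expectation (prior_others I a) (\<lambda>\<theta>. \<phi> (\<theta>(a := t))))"
  unfolding prior_def prior_others_def using marketD[OF assms(1)] assms(2)
  by (intro expectation_Pi_pmf_split) auto

lemma utility_eq: "utility I M a t \<theta> = val I a t * served I M a \<theta> - payment M \<theta> a"
  by (simp add: utility_def val_def served_def)

lemma interim_utility_eq:
  assumes "matching_market I"
  shows "interim_utility I M a t r = val I a t * interim_alloc I M a r - interim_pay I M a r"
  unfolding interim_utility_def interim_alloc_def interim_pay_def utility_eq
  using finite_prior[OF assms] by (simp add: integrable_measure_pmf_finite)

text \<open>Feasible matchings use compatible edges only, so the sum may run over all buyer-seller
  pairs and then be regrouped by agent.\<close>

lemma gains_eq:
  assumes I: "matching_market I" and M: "is_mechanism I M" and \<theta>: "\<theta> \<in> profiles I"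
  shows "(\<Sum>(i, j)\<in>edges I. (\<theta> i - \<theta> j) * edge_prob M \<theta> i j) = (\<Sum>a\<in>agents I. val I a (\<theta> a) * served I M a \<theta>)"
proof -
  note m = marketD[OF I]
  have z: "edge_prob M \<theta> i j = 0" if "(i, j) \<notin> edges I" for i j
  proof -
    have "set_pmf (alloc M \<theta>) \<inter> {m. (i, j) \<in> m} = {}"
      using M \<theta> m(7) that by (fastforce simp: is_mechanism_def matching_def)
    then show ?thesis unfolding edge_prob_def by (simp add: measure_pmf_zero_iff)
  qed
  have "(\<Sum>(i, j)\<in>edges I. (\<theta> i - \<theta> j) * edge_prob M \<theta> i j) =
      (\<Sum>(i, j)\<in>buyers I \<times> sellers I. (\<theta> i - \<theta> j) * edge_prob M \<theta> i j)"
    using m z by (intro sum.mono_neutral_left) auto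
  also have "\<dots> = (\<Sum>i\<in>buyers I. \<Sum>j\<in>sellers I. \<theta> i * edge_prob M \<theta> i j) - (\<Sum>i\<in>buyers I. \<Sum>j\<in>sellers I. \<theta> j * edge_prob M \<theta> i j)"
    by (simp add: sum.cartesian_product[symmetric] left_diff_distrib sum_subtractf)
  also have "(\<Sum>i\<in>buyers I. \<Sum>j\<in>sellers I. \<theta> i * edge_prob M \<theta> i j) = (\<Sum>a\<in>buyers I. val I a (\<theta> a) * served I M a \<theta>)"
    by (intro sum.cong) (auto simp: val_def served_def sum_distrib_left)
  also have "(\<Sum>i\<in>buyers I. \<Sum>j\<in>sellers I. \<theta> j * edge_prob M \<theta> i j) = - (\<Sum>a\<in>sellers I. val I a (\<theta> a) * served I M a \<theta>)"
    unfolding sum_negf[symmetric] using m(4)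
    by (subst sum.swap) (intro sum.cong, auto simp: val_def served_def sum_distrib_left sum_negf)
  finally show ?thesis unfolding agents_def using m by (simp add: sum.union_disjoint)
qed

text \<open>Both GFT and Rev are sums over agents, and conditioning on an agent's own type leaves
  only the interim allocation and payment of that agent.\<close>

lemma objective_eq:
  assumes I: "matching_market I" and M: "is_mechanism I M"
  shows "GFT I M + \<alpha> * Rev I M = (\<Sum>a\<in>agents I. \<Sum>t\<in>set_pmf (type_dist I a). pmf (type_dist I a) t *
     (val I a t * interim_alloc I M a t + \<alpha> * interim_pay I M a t))"
proof -
  note fin = integrable_measure_pmf_finite[OF finite_prior(1)[OF I]]
  have "GFT I M = measure_pmf.expectation (prior I) (\<lambda>\<theta>. \<Sum>a\<in>agents I. val I a (\<theta> a) * served I M a \<theta>)"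
    unfolding GFT_def using gains_eq[OF I M] set_prior[OF I]
    by (intro integral_cong_AE) (auto simp: AE_measure_pmf_iff)
  also have "\<dots> = (\<Sum>a\<in>agents I. measure_pmf.expectation (prior I) (\<lambda>\<theta>. val I a (\<theta> a) * served I M a \<theta>))"
    by (rule Bochner_Integration.integral_sum) (rule fin)
  also have "\<dots> = (\<Sum>a\<in>agents I. \<Sum>t\<in>set_pmf (type_dist I a). pmf (type_dist I a) t * (val I a t * interim_alloc I M a t))"
    by (intro sum.cong) (auto simp: prior_split[OF I] interim_alloc_def)
  finally have G: "GFT I M = (\<Sum>a\<in>agents I. \<Sum>t\<in>set_pmf (type_dist I a). pmf (type_dist I a) t * (val I a t * interim_alloc I M a t))" .
  have "Rev I M = (\<Sum>a\<in>agents I. measure_pmf.expectation (prior I) (\<lambda>\<theta>. payment M \<theta> a))"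
    unfolding Rev_def by (rule Bochner_Integration.integral_sum) (rule fin)
  also have "\<dots> = (\<Sum>a\<in>agents I. \<Sum>t\<in>set_pmf (type_dist I a). pmf (type_dist I a) t * interim_pay I M a t)"
    by (intro sum.cong) (auto simp: prior_split[OF I] interim_pay_def)
  finally have R: "Rev I M = (\<Sum>a\<in>agents I. \<Sum>t\<in>set_pmf (type_dist I a). pmf (type_dist I a) t * interim_pay I M a t)" .
  show ?thesis unfolding G R sum_distrib_left sum.distrib[symmetric]
    by (intro sum.cong) (auto simp: algebra_simps)
qed

section \<open>The bilateral hypothesis in interim form\<close>

text \<open>The instance has buyer 0 with values from \<open>F\<close> and seller 1 whose costs are
  the mirror image of \<open>G\<close>. The slack \<open>\<epsilon>\<close> is there because a
  supremum yields only mechanisms that come arbitrarily close.\<close>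

lemma bilateral_attainable:
  fixes F G :: "real pmf"
  assumes hyp: "\<forall>I :: nat market. bilateral_trade I \<longrightarrow> V \<alpha> I \<ge> ereal (\<beta> * FB I)"
    and fin: "finite (set_pmf F)" "finite (set_pmf G)"
  shows "attainable \<alpha> \<beta> F G"
  unfolding attainable_def
proof (intro allI impI)
  fix \<epsilon> :: real assume \<epsilon>: "\<epsilon> > 0"
  define G' where "G' = map_pmf uminus G"
  define I :: "nat market" where "I = \<lparr>buyers = {0}, sellers = {1}, edges = {(0, 1)},
     feasible = {{}, {(0, 1)}}, type_dist = (\<lambda>a. if a = 0 then F else G')\<rparr>"
  have sel: "buyers I = {0}" "sellers I = {1}" "edges I = {(0, 1)}" "feasible I = {{}, {(0, 1)}}"
    "type_dist I 0 = F" "type_dist I 1 = G'" "type_dist I (Suc 0) = G'" "agents I = {0, 1}" by (auto simp: I_def agents_def)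
  have I: "matching_market I"
    using fin unfolding matching_market_def sel by (auto simp: matching_def sel G'_def)
  then have "bilateral_trade I" by (simp add: bilateral_trade_def sel)
  then have "ereal (\<beta> * FB I) \<le> V \<alpha> I" using hyp by blast
  then have "ereal (\<beta> * FB I - \<epsilon>) < V \<alpha> I" using \<epsilon> by (simp add: less_le_trans[of _ "ereal (\<beta> * FB I)"])
  then obtain M where M: "is_mechanism I M" "BIC I M" "IIR I M" and obj: "\<beta> * FB I - \<epsilon> < GFT I M + \<alpha> * Rev I M"
    unfolding V_def less_SUP_iff by auto
  define prof where "prof v c = (\<lambda>a::nat. if a = 0 then v else if a = 1 then c else 0 :: real)" for v c
  have split: "measure_pmf.expectation (Pi_pmf {a} 0 (type_dist I)) \<phi> = (\<Sum>t\<in>set_pmf (type_dist I a). pmf (type_dist I a) t * \<phi> ((\<lambda>_. 0)(a := t)))"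
    if "a \<in> {0, 1}" for a :: nat and \<phi> :: "(nat \<Rightarrow> real) \<Rightarrow> real"
    using that fin by (subst expectation_Pi_pmf_split[of "{a}" a]) (auto simp: sel G'_def)
  have o0: "prior_others I 0 = Pi_pmf {1} 0 (type_dist I)" and o1: "prior_others I 1 = Pi_pmf {0} 0 (type_dist I)"
    unfolding prior_others_def sel by (simp_all add: insert_Diff_if)
  have p0: "((\<lambda>_. 0)(1 := c))(0 := v) = prof v c" and p1: "((\<lambda>_. 0)(0 := v))(1 := c) = prof v c" for v c
    by (auto simp: prof_def fun_eq_iff)
  have s0: "measure_pmf.expectation (Pi_pmf {0} 0 (type_dist I)) \<phi> = (\<Sum>v\<in>set_pmf F. pmf F v * \<phi> ((\<lambda>_. 0)(0 := v)))"
    and s1: "measure_pmf.expectation (Pi_pmf {1} 0 (type_dist I)) \<phi> = (\<Sum>c\<in>set_pmf G'. pmf G' c * \<phi> ((\<lambda>_. 0)(1 := c)))"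
    for \<phi> :: "(nat \<Rightarrow> real) \<Rightarrow> real"
    using split[of 0 \<phi>] split[of 1 \<phi>] by (simp_all add: sel)
  define e where "e v b = edge_prob M (prof v (- b)) 0 1" for v b
  have sumG: "(\<Sum>c\<in>set_pmf G'. pmf G' c * \<phi> c) = (\<Sum>b\<in>set_pmf G. pmf G b * \<phi> (- b))" for \<phi> :: "real \<Rightarrow> real"
    unfolding G'_def by (rule sum_map_pmf_inj) (auto simp: inj_def)
  have X: "interim_alloc I M 0 v = (\<Sum>b\<in>set_pmf G. pmf G b * e v b)" for v
    unfolding interim_alloc_def o0 s1 p0 sumG
    by (simp add: served_def sel e_def)
  have Y: "interim_alloc I M 1 (- b) = (\<Sum>v\<in>set_pmf F. pmf F v * e v b)" for b
    unfolding interim_alloc_def o1 s0 p1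
    by (simp add: served_def sel e_def)
  have FB: "FB I = (\<Sum>v\<in>set_pmf F. \<Sum>b\<in>set_pmf G. pmf F v * pmf G b * max 0 (v + b))"
  proof -
    have "FB I = (\<Sum>v\<in>set_pmf F. pmf F v * (\<Sum>c\<in>set_pmf G'. pmf G' c * max 0 (v - c)))"
      unfolding FB_def prior_split[OF I, of 0, unfolded sel, OF insertI1] o0 s1 p0
      by (simp add: prof_def sel)
    then show ?thesis unfolding sumG by (simp add: sum_distrib_left mult.assoc)
  qed
  have val: "val I 0 v = v" "val I 1 c = - c" "val I (Suc 0) c = - c" for v c by (auto simp: val_def sel)
  have T0: "truthful (set_pmf F) (\<lambda>v. \<Sum>b\<in>set_pmf G. pmf G b * e v b) (interim_pay I M 0)"
    using M(2,3) unfolding truthful_def BIC_def IIR_def sel interim_utility_eq[OF I] X[symmetric]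
    by (auto simp: val sel)
  have T1: "truthful (set_pmf G) (\<lambda>b. \<Sum>v\<in>set_pmf F. pmf F v * e v b) (\<lambda>b. interim_pay I M 1 (- b))"
    using M(2,3) unfolding truthful_def BIC_def IIR_def sel interim_utility_eq[OF I] Y[symmetric]
    by (auto simp: val sel G'_def)
  have "GFT I M + \<alpha> * Rev I M =
    (\<Sum>v\<in>set_pmf F. pmf F v * (v * interim_alloc I M 0 v + \<alpha> * interim_pay I M 0 v)) +
    (\<Sum>c\<in>set_pmf G'. pmf G' c * (- c * interim_alloc I M 1 c + \<alpha> * interim_pay I M 1 c))"
    unfolding objective_eq[OF I M(1)] sel by (simp add: val sel)
  also have "\<dots> = (\<Sum>v\<in>set_pmf F. pmf F v * (v * (\<Sum>b\<in>set_pmf G. pmf G b * e v b) + \<alpha> * interim_pay I M 0 v)) +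
    (\<Sum>b\<in>set_pmf G. pmf G b * (b * (\<Sum>v\<in>set_pmf F. pmf F v * e v b) + \<alpha> * interim_pay I M 1 (- b)))"
    unfolding sumG X Y by simp
  finally have "\<beta> * (\<Sum>v\<in>set_pmf F. \<Sum>b\<in>set_pmf G. pmf F v * pmf G b * max 0 (v + b)) - \<epsilon> \<le>
    (\<Sum>v\<in>set_pmf F. pmf F v * (v * (\<Sum>b\<in>set_pmf G. pmf G b * e v b) + \<alpha> * interim_pay I M 0 v)) +
    (\<Sum>b\<in>set_pmf G. pmf G b * (b * (\<Sum>v\<in>set_pmf F. pmf F v * e v b) + \<alpha> * interim_pay I M 1 (- b)))"
    using obj FB by simp
  moreover have "\<forall>v b. 0 \<le> e v b \<and> e v b \<le> 1" by (simp add: e_def edge_prob_def)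
  ultimately show "\<exists>e P R. (\<forall>v b. 0 \<le> e v b \<and> e v b \<le> (1::real)) \<and>
     truthful (set_pmf F) (\<lambda>v. \<Sum>b\<in>set_pmf G. pmf G b * e v b) P \<and>
     truthful (set_pmf G) (\<lambda>b. \<Sum>v\<in>set_pmf F. pmf F v * e v b) R \<and>
     \<beta> * (\<Sum>v\<in>set_pmf F. \<Sum>b\<in>set_pmf G. pmf F v * pmf G b * max 0 (v + b)) - \<epsilon> \<le>
     (\<Sum>v\<in>set_pmf F. pmf F v * (v * (\<Sum>b\<in>set_pmf G. pmf G b * e v b) + \<alpha> * P v)) +
     (\<Sum>b\<in>set_pmf G. pmf G b * (b * (\<Sum>v\<in>set_pmf F. pmf F v * e v b) + \<alpha> * R b))"
    using T0 T1 by blast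
qed

section \<open>The ironed mechanism\<close>

definition covered :: "'a market \<Rightarrow> 'a \<Rightarrow> ('a \<times> 'a) set \<Rightarrow> real" where
  "covered I a N = (if a \<in> buyers I then \<Sum>j\<in>sellers I. of_bool ((a, j) \<in> N)
     else \<Sum>i\<in>buyers I. of_bool ((i, a) \<in> N))"

text \<open>Summing over agents rather than edges makes the effect of changing one value visible:
  the weight changes by the increment times \<open>covered\<close>.\<close>

definition weight :: "'a market \<Rightarrow> ('a \<Rightarrow> real) \<Rightarrow> ('a \<times> 'a) set \<Rightarrow> real" where
  "weight I z N = (\<Sum>a\<in>agents I. z a * covered I a N)"

lemma weight_eq:
  assumes I: "matching_market I" and N: "N \<subseteq> edges I"
  shows "weight I z N = (\<Sum>(i, j)\<in>N. z i + z j)"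
proof -
  note m = marketD[OF I]
  have "(\<Sum>(i, j)\<in>N. z i + z j) = (\<Sum>(i, j)\<in>buyers I \<times> sellers I. (z i + z j) * of_bool ((i, j) \<in> N))"
    using m N by (intro sum.mono_neutral_cong_left) auto
  also have "\<dots> = (\<Sum>i\<in>buyers I. \<Sum>j\<in>sellers I. z i * of_bool ((i, j) \<in> N)) + (\<Sum>i\<in>buyers I. \<Sum>j\<in>sellers I. z j * of_bool ((i, j) \<in> N))"
    by (simp only: sum.cartesian_product[symmetric] distrib_right sum.distrib)
  also have "(\<Sum>i\<in>buyers I. \<Sum>j\<in>sellers I. z i * of_bool ((i, j) \<in> N)) = (\<Sum>a\<in>buyers I. z a * covered I a N)"
    by (intro sum.cong) (auto simp: covered_def sum_distrib_left)
  also have "(\<Sum>i\<in>buyers I. \<Sum>j\<in>sellers I. z j * of_bool ((i, j) \<in> N)) = (\<Sum>a\<in>sellers I. z a * covered I a N)"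
    using m(4) by (subst sum.swap) (intro sum.cong, auto simp: covered_def sum_distrib_left)
  finally show ?thesis unfolding weight_def agents_def using m by (simp add: sum.union_disjoint)
qed

lemma sum_of_bool_unique:
  assumes "finite A" "\<And>x y. x \<in> A \<Longrightarrow> y \<in> A \<Longrightarrow> P x \<Longrightarrow> P y \<Longrightarrow> x = y"
  shows "(\<Sum>x\<in>A. of_bool (P x)) = (of_bool (\<exists>x\<in>A. P x) :: real)"
proof (cases "\<exists>x\<in>A. P x")
  case True
  then obtain x where x: "x \<in> A" "P x" by blast
  then have "A \<inter> {x. P x} = {x}" using assms(2) by auto
  then show ?thesis using True assms(1) by simp
next
  case False
  then show ?thesis by simp
qed

lemma covered_01:
  assumes I: "matching_market I" and N: "N \<in> feasible I"
  shows "covered I a N \<in> {0, 1}"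
proof -
  note m = marketD[OF I]
  have u: "j = j'" if "(a, j) \<in> N" "(a, j') \<in> N" for j j'
    using m(7)[OF N] that unfolding matching_def by (metis prod.inject)
  have u': "i = i'" if "(i, a) \<in> N" "(i', a) \<in> N" for i i'
    using m(7)[OF N] that unfolding matching_def by (metis prod.inject)
  have "(\<Sum>j\<in>sellers I. of_bool ((a, j) \<in> N)) = (of_bool (\<exists>j\<in>sellers I. (a, j) \<in> N) :: real)"
    by (rule sum_of_bool_unique[OF m(3)]) (rule u)
  moreover have "(\<Sum>i\<in>buyers I. of_bool ((i, a) \<in> N)) = (of_bool (\<exists>i\<in>buyers I. (i, a) \<in> N) :: real)"
    by (rule sum_of_bool_unique[OF m(2)]) (rule u')
  ultimately show ?thesis unfolding covered_def by (cases "a \<in> buyers I") auto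
qed

lemma covered_edge:
  assumes I: "matching_market I" and N: "N \<in> feasible I" and e: "(i, j) \<in> N"
  shows "covered I i N = 1" "covered I j N = 1"
proof -
  note m = marketD[OF I]
  have ij: "i \<in> buyers I" "j \<in> sellers I" "j \<notin> buyers I"
    using e m(7)[OF N] m(4,5) by (auto simp: matching_def)
  have "0 < covered I i N"
    unfolding covered_def using ij e m by (auto intro!: sum_pos2[of _ j])
  then show "covered I i N = 1" using covered_01[OF I N, of i] by auto
  have "0 < covered I j N"
    unfolding covered_def using ij e m by (auto intro!: sum_pos2[of _ i])
  then show "covered I j N = 1" using covered_01[OF I N, of j] by auto
qed

text \<open>Breaking ties by a fixed ranking keeps the chosen matching, and not only its weight,
  monotone in the agents' values.\<close>

definition consistent_argmax :: "('z \<Rightarrow> 'b \<Rightarrow> real) \<Rightarrow> 'b set \<Rightarrow> ('z \<Rightarrow> 'b) \<Rightarrow> bool" where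
  "consistent_argmax W \<F> best \<longleftrightarrow> (\<forall>z. best z \<in> \<F> \<and> (\<forall>N\<in>\<F>. W z N \<le> W z (best z))) \<and>
     (\<forall>z z' Q \<delta>. best z \<in> Q \<longrightarrow> (\<forall>N\<in>\<F>. W z' N \<le> W z N + \<delta>) \<longrightarrow>
        (\<forall>N\<in>\<F> \<inter> Q. W z' N = W z N + \<delta>) \<longrightarrow> best z' \<in> Q)"

lemma consistent_argmaxD:
  assumes "consistent_argmax W \<F> best"
  shows "best z \<in> \<F>" "N \<in> \<F> \<Longrightarrow> W z N \<le> W z (best z)"
  using assms by (auto simp: consistent_argmax_def)

lemma consistent_argmax_stays:
  assumes "consistent_argmax W \<F> best" "best z \<in> Q"
    and "\<And>N. N \<in> \<F> \<Longrightarrow> W z' N \<le> W z N + \<delta>"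
    and "\<And>N. N \<in> \<F> \<Longrightarrow> N \<in> Q \<Longrightarrow> W z' N = W z N + \<delta>"
  shows "best z' \<in> Q"
  using assms unfolding consistent_argmax_def by (metis IntE)

text \<open>An injective rank \<open>r\<close> makes the order by weight and rank strict. If the
  choice left \<open>Q\<close>, the new choice would beat the old one at \<open>z'\<close> although
  its weight gained no more than that of the old one, contradicting the strict order at
  \<open>z\<close>.\<close>

lemma consistent_argmax_exists:
  fixes W :: "'z \<Rightarrow> 'b \<Rightarrow> real"
  assumes "finite \<F>" "\<F> \<noteq> {}"
  shows "\<exists>best. consistent_argmax W \<F> best"
proof -
  obtain r :: "'b \<Rightarrow> nat" where r: "inj_on r \<F>" using finite_imp_inj_to_nat_seg[OF assms(1)] by blast
  have "\<exists>N\<in>\<F>. \<forall>N'\<in>\<F>. N' \<noteq> N \<longrightarrow> W z N' < W z N \<or> (W z N' = W z N \<and> r N' < r N)" for z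
  proof -
    define A where "A = {N\<in>\<F>. \<forall>N'\<in>\<F>. W z N' \<le> W z N}"
    have "Max (W z ` \<F>) \<in> W z ` \<F>" using assms by (intro Max_in) auto
    then obtain N0 where "N0 \<in> \<F>" "W z N0 = Max (W z ` \<F>)" by auto
    then have "N0 \<in> \<F>" "\<forall>N'\<in>\<F>. W z N' \<le> W z N0" using assms by auto
    then have A: "finite A" "A \<noteq> {}" using assms(1) by (auto simp: A_def)
    have "Max (r ` A) \<in> r ` A" using A by (intro Max_in) auto
    then obtain N where "N \<in> A" "r N = Max (r ` A)" by auto
    then have N: "N \<in> A" "\<And>N'. N' \<in> A \<Longrightarrow> r N' \<le> r N" using A by auto
    have "W z N' < W z N \<or> (W z N' = W z N \<and> r N' < r N)" if N': "N' \<in> \<F>" "N' \<noteq> N" for N'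
    proof (cases "N' \<in> A")
      case True
      then have "r N' \<noteq> r N" using r N' N(1) by (auto simp: A_def inj_on_def)
      then show ?thesis using N(2)[OF True] True N(1) by (force simp: A_def)
    next
      case False
      then obtain N'' where "N'' \<in> \<F>" "W z N' < W z N''" using N'(1) unfolding A_def by (auto simp: not_le)
      moreover have "W z N'' \<le> W z N" using N(1) \<open>N'' \<in> \<F>\<close> by (simp add: A_def)
      ultimately show ?thesis by simp
    qed
    then show ?thesis using N(1) by (auto simp: A_def)
  qed
  then obtain best where best: "\<And>z. best z \<in> \<F>"
    "\<And>z N. N \<in> \<F> \<Longrightarrow> N \<noteq> best z \<Longrightarrow> W z N < W z (best z) \<or> (W z N = W z (best z) \<and> r N < r (best z))"
    by metis
  show ?thesis
    unfolding consistent_argmax_def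
  proof (intro exI[of _ best] conjI allI ballI impI)
    show "best z \<in> \<F>" for z by (rule best)
    show "W z N \<le> W z (best z)" if "N \<in> \<F>" for z N using best(2)[OF that, of z] by (cases "N = best z") auto
    fix z z' Q \<delta>
    assume Q: "best z \<in> Q" and le: "\<forall>N\<in>\<F>. W z' N \<le> W z N + \<delta>"
      and eq: "\<forall>N\<in>\<F> \<inter> Q. W z' N = W z N + \<delta>"
    show "best z' \<in> Q"
    proof (rule ccontr)
      assume "best z' \<notin> Q"
      then have ne: "best z' \<noteq> best z" using Q by auto
      have 1: "W z (best z') < W z (best z) \<or> (W z (best z') = W z (best z) \<and> r (best z') < r (best z))"
        using best(2)[OF best(1) ne] .
      have 2: "W z' (best z) < W z' (best z') \<or> (W z' (best z) = W z' (best z') \<and> r (best z) < r (best z'))"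
        using best(2)[OF best(1) ne[symmetric]] .
      show False using 1 2 le[rule_format, OF best(1), of z'] eq[rule_format, of "best z"] best(1)[of z] Q by auto
    qed
  qed
qed

section \<open>Monotonicity of the selected matching\<close>

text \<open>Raising the value of \<open>a\<close> gives matchings that cover \<open>a\<close> the
  full increment and the others nothing, so a choice that covers \<open>a\<close> stays in that
  class.\<close>

lemma covered_monotone:
  assumes I: "matching_market I" and a: "a \<in> agents I"
    and best: "consistent_argmax (weight I) (feasible I) best"
    and z: "z a \<le> z' a" "\<And>b. b \<noteq> a \<Longrightarrow> z' b = z b"
  shows "covered I a (best z) \<le> covered I a (best z')"
proof (cases "covered I a (best z) = 1")
  case True
  have fin: "finite (agents I)" using marketD[OF I] by blast
  have w: "weight I z' N = weight I z N + (z' a - z a) * covered I a N" for N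
    unfolding weight_def sum.remove[OF fin a] using z(2) by (simp add: algebra_simps)
  have "best z' \<in> {N. covered I a N = 1}"
  proof (rule consistent_argmax_stays[OF best, of z])
    fix N assume "N \<in> feasible I"
    then have "covered I a N \<le> 1" using covered_01[OF I, of N a] by auto
    then show "weight I z' N \<le> weight I z N + (z' a - z a)"
      unfolding w using z(1) by (simp add: mult_left_le)
  qed (use True in \<open>auto simp: w\<close>)
  then show ?thesis using True by simp
next
  case False
  then show ?thesis using covered_01[OF I consistent_argmaxD(1)[OF best], of a z] covered_01[OF I consistent_argmaxD(1)[OF best], of a z'] by auto
qed

text \<open>Matchings containing the edge gain both increments in full, while any other covers each
  end at most once and gains no more. So the values of the two ends for which the edge is chosen
  form an upper set.\<close>

lemma edge_monotone:
  assumes I: "matching_market I" and e: "(i, j) \<in> edges I"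
    and best: "consistent_argmax (weight I) (feasible I) best"
    and z: "z i \<le> z' i" "z j \<le> z' j" "\<And>b. b \<noteq> i \<Longrightarrow> b \<noteq> j \<Longrightarrow> z' b = z b"
    and ij: "(i, j) \<in> best z"
  shows "(i, j) \<in> best z'"
proof -
  note m = marketD[OF I]
  have a: "i \<in> agents I" "j \<in> agents I - {i}" using e m by (auto simp: agents_def)
  have w: "weight I z' N = weight I z N + (z' i - z i) * covered I i N + (z' j - z j) * covered I j N" for N
    unfolding weight_def sum.remove[OF m(1) a(1)] sum.remove[OF finite_Diff[OF m(1)] a(2)]
    using z(3) by (simp add: algebra_simps)
  have "best z' \<in> {N. (i, j) \<in> N}"
  proof (rule consistent_argmax_stays[OF best, of z])
    fix N assume N: "N \<in> feasible I"
    then have "covered I i N \<le> 1" "covered I j N \<le> 1"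
      using covered_01[OF I, of N i] covered_01[OF I, of N j] by auto
    then show "weight I z' N \<le> weight I z N + ((z' i - z i) + (z' j - z j))"
      unfolding w using z(1,2) mult_left_le[of "covered I i N" "z' i - z i"] mult_left_le[of "covered I j N" "z' j - z j"] by simp
  next
    fix N assume "N \<in> feasible I" "N \<in> {N. (i, j) \<in> N}"
    then show "weight I z' N = weight I z N + ((z' i - z i) + (z' j - z j))"
      unfolding w using covered_edge[OF I, of N i j] by simp
  qed (use ij in simp)
  then show ?thesis by simp
qed

definition value_dist :: "'a market \<Rightarrow> 'a \<Rightarrow> real pmf" where
  "value_dist I a = map_pmf (val I a) (type_dist I a)"

definition vals :: "'a market \<Rightarrow> ('a \<Rightarrow> real) \<Rightarrow> 'a \<Rightarrow> real" where
  "vals I \<theta> a = val I a (\<theta> a)"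

lemma sum_value_dist:
  "(\<Sum>z\<in>set_pmf (value_dist I a). pmf (value_dist I a) z * \<phi> z) =
   (\<Sum>t\<in>set_pmf (type_dist I a). pmf (type_dist I a) t * (\<phi> (val I a t) :: real))"
  unfolding value_dist_def by (rule sum_map_pmf_inj) (rule inj_val)

text \<open>The lower bound is Myerson's: maximize ironed virtual surplus.\<close>

lemma V_ge_ironed:
  assumes I: "matching_market I"
    and h: "\<And>a. a \<in> agents I \<Longrightarrow> ironed \<alpha> (pmf (value_dist I a)) (set_pmf (value_dist I a)) (h a)"
    and best: "consistent_argmax (weight I) (feasible I) best"
  defines "hats \<equiv> \<lambda>\<theta> a. h a (vals I \<theta> a)"
  shows "ereal (measure_pmf.expectation (prior I) (\<lambda>\<theta>. weight I (hats \<theta>) (best (hats \<theta>)))) \<le> V \<alpha> I"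
proof -
  note m = marketD[OF I]
  define S where "S a = set_pmf (value_dist I a)" for a
  have finS: "finite (S a)" if "a \<in> agents I" for a using m(9)[OF that] by (simp add: S_def value_dist_def)
  define X where "X a z = measure_pmf.expectation (prior_others I a)
      (\<lambda>\<theta>. covered I a (best (hats (\<theta>(a := val I a z)))))" for a z
  \<comment> \<open>Comparing through \<open>h\<close> covers equality in both directions:
    \<open>X\<close> is constant on the levels of \<open>h\<close>, so its jumps, and with them the
    thresholds, occur only at jumps of \<open>h\<close>.\<close>
  have Xmono: "X a z \<le> X a z'" if a: "a \<in> agents I" and "h a z \<le> h a z'" for a z z'
    unfolding X_def
  proof (rule integral_mono[OF integrable_measure_pmf_finite integrable_measure_pmf_finite])
    fix \<theta>
    show "covered I a (best (hats (\<theta>(a := val I a z)))) \<le> covered I a (best (hats (\<theta>(a := val I a z'))))"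
      by (rule covered_monotone[OF I a best]) (use that in \<open>auto simp: hats_def vals_def\<close>)
  qed (use finite_prior[OF I] in auto)
  have X0: "0 \<le> X a z" for a z
    unfolding X_def using covered_01[OF I consistent_argmaxD(1)[OF best]] by (intro integral_nonneg_AE AE_I2) (metis insertE order_refl singletonD zero_le_one)
  have "\<forall>a\<in>agents I. \<exists>d. (\<forall>s. 0 \<le> d s) \<and> (\<forall>t\<in>S a. X a t = quantity d (S a) t) \<and>
             (\<forall>s\<in>S a. d s \<noteq> 0 \<longrightarrow> (\<forall>t\<in>S a. t < s \<longrightarrow> X a t < X a s))"
  proof
    fix a assume a: "a \<in> agents I"
    have "mono_on (S a) (h a)" using h[OF a] by (simp add: ironed_def S_def)
    then have "mono_on (S a) (X a)" using Xmono[OF a] by (auto simp: mono_on_def)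
    then show "\<exists>d. (\<forall>s. 0 \<le> d s) \<and> (\<forall>t\<in>S a. X a t = quantity d (S a) t) \<and>
             (\<forall>s\<in>S a. d s \<noteq> 0 \<longrightarrow> (\<forall>t\<in>S a. t < s \<longrightarrow> X a t < X a s))"
      using threshold_decomposition[OF finS[OF a]] X0 by blast
  qed
  then obtain d where d: "\<And>a s. a \<in> agents I \<Longrightarrow> 0 \<le> d a s"
    "\<And>a t. a \<in> agents I \<Longrightarrow> t \<in> S a \<Longrightarrow> X a t = quantity (d a) (S a) t"
    "\<And>a s t. a \<in> agents I \<Longrightarrow> s \<in> S a \<Longrightarrow> d a s \<noteq> 0 \<Longrightarrow> t \<in> S a \<Longrightarrow> t < s \<Longrightarrow> X a t < X a s"
    by metis
  \<comment> \<open>A payment that depends on the own report alone coincides with its interim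
    expectation, so the interim analysis applies to it directly.\<close>
  define M :: "'a mechanism" where "M = \<lparr>alloc = (\<lambda>\<theta>. return_pmf (best (hats \<theta>))),
     payment = (\<lambda>\<theta> a. price (d a) (S a) (vals I \<theta> a))\<rparr>"
  have mech: "is_mechanism I M" using consistent_argmaxD(1)[OF best] by (simp add: is_mechanism_def M_def)
  have ep: "edge_prob M \<theta> i j = of_bool ((i, j) \<in> best (hats \<theta>))" for \<theta> i j
    by (simp add: edge_prob_def M_def indicator_def)
  have sv: "served I M a \<theta> = covered I a (best (hats \<theta>))" for a \<theta>
    by (simp add: served_def covered_def ep)
  have ia: "interim_alloc I M a t = X a (val I a t)" for a t
    by (simp add: interim_alloc_def X_def sv)
  have ip: "interim_pay I M a t = price (d a) (S a) (val I a t)" for a t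
    by (simp add: interim_pay_def M_def vals_def)
  have inS: "val I a t \<in> S a" if "t \<in> set_pmf (type_dist I a)" for a t
    using that by (auto simp: S_def value_dist_def)
  have IU: "interim_utility I M a t r = val I a t * quantity (d a) (S a) (val I a r) - price (d a) (S a) (val I a r)"
    if "a \<in> agents I" "r \<in> set_pmf (type_dist I a)" for a t r
    using that d(2) inS by (simp add: interim_utility_eq[OF I] ia ip)
  have "BIC I M" unfolding BIC_def
    using rent_truthful[OF finS d(1)] by (simp add: IU rent_eq)
  moreover have "IIR I M" unfolding IIR_def
    using rent_nonneg[OF d(1)] by (simp add: IU rent_eq[symmetric])
  ultimately have "ereal (GFT I M + \<alpha> * Rev I M) \<le> V \<alpha> I"
    unfolding V_def using mech by (intro SUP_upper) auto
  also have "GFT I M + \<alpha> * Rev I M = (\<Sum>a\<in>agents I. measure_pmf.expectation (prior I) (\<lambda>\<theta>. hats \<theta> a * covered I a (best (hats \<theta>))))"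
    unfolding objective_eq[OF I mech]
  proof (intro sum.cong refl)
    fix a assume a: "a \<in> agents I"
    have "(\<Sum>t\<in>set_pmf (type_dist I a). pmf (type_dist I a) t * (val I a t * interim_alloc I M a t + \<alpha> * interim_pay I M a t))
       = (\<Sum>z\<in>S a. pmf (value_dist I a) z * (z * X a z + \<alpha> * price (d a) (S a) z))"
      unfolding S_def ia ip sum_value_dist ..
    also have "\<dots> = (\<Sum>z\<in>S a. pmf (value_dist I a) z * (z * quantity (d a) (S a) z + \<alpha> * price (d a) (S a) z))"
      using d(2)[OF a] by (intro sum.cong) auto
    also have "\<dots> = (\<Sum>z\<in>S a. pmf (value_dist I a) z * (h a z * quantity (d a) (S a) z))"
    proof (rule ironed_eq[OF _ finS[OF a]])
      show "ironed \<alpha> (pmf (value_dist I a)) (S a) (h a)" using h[OF a] by (simp add: S_def)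
      fix s t assume "s \<in> S a" "d a s \<noteq> 0" "t \<in> S a" "t < s"
      then have "X a t < X a s" using d(3)[OF a] by blast
      then show "h a t < h a s" using Xmono[OF a, of s t] by force
    qed
    also have "\<dots> = (\<Sum>z\<in>S a. pmf (value_dist I a) z * (h a z * X a z))"
      using d(2)[OF a] by (intro sum.cong) auto
    also have "\<dots> = (\<Sum>t\<in>set_pmf (type_dist I a). pmf (type_dist I a) t * (h a (val I a t) * X a (val I a t)))"
      unfolding S_def by (rule sum_value_dist)
    also have "\<dots> = measure_pmf.expectation (prior I) (\<lambda>\<theta>. hats \<theta> a * covered I a (best (hats \<theta>)))"
      unfolding prior_split[OF I a] by (simp add: X_def hats_def vals_def)
    finally show "(\<Sum>t\<in>set_pmf (type_dist I a). pmf (type_dist I a) t * (val I a t * interim_alloc I M a t + \<alpha> * interim_pay I M a t)) = \<dots>" .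
  qed
  also have "\<dots> = measure_pmf.expectation (prior I) (\<lambda>\<theta>. weight I (hats \<theta>) (best (hats \<theta>)))"
    unfolding weight_def
    by (rule Bochner_Integration.integral_sum[symmetric]) (rule integrable_measure_pmf_finite[OF finite_prior(1)[OF I]])
  finally show ?thesis .
qed

section \<open>From single edges to the whole market\<close>

text \<open>Conditioning on the types of all agents except \<open>i\<close> and \<open>j\<close>
  leaves a region in the plane of their two values, to which \<open>edge_inequality\<close> applies.
  By independence the two distributions, and so their ironed values, are the same in every
  slice.\<close>

lemma edge_expectation:
  assumes I: "matching_market I" and e: "(i, j) \<in> edges I" and \<alpha>: "\<alpha> \<ge> 0" and \<beta>: "\<beta> \<ge> 0"
    and att: "\<And>F G :: real pmf. finite (set_pmf F) \<Longrightarrow> finite (set_pmf G) \<Longrightarrow> attainable \<alpha> \<beta> F G"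
    and h: "\<And>a. a \<in> agents I \<Longrightarrow> ironed \<alpha> (pmf (value_dist I a)) (set_pmf (value_dist I a)) (h a)"
    and nonneg: "\<And>z. (i, j) \<in> best z \<Longrightarrow> 0 \<le> z i + z j"
    and mono: "\<And>z z'. z i \<le> z' i \<Longrightarrow> z j \<le> z' j \<Longrightarrow> (\<And>b. b \<noteq> i \<Longrightarrow> b \<noteq> j \<Longrightarrow> z' b = z b) \<Longrightarrow>
       (i, j) \<in> best z \<Longrightarrow> (i, j) \<in> best z'"
  shows "\<beta> * measure_pmf.expectation (prior I) (\<lambda>\<theta>. of_bool ((i, j) \<in> best (vals I \<theta>)) * (vals I \<theta> i + vals I \<theta> j))
    \<le> measure_pmf.expectation (prior I) (\<lambda>\<theta>. of_bool ((i, j) \<in> best (vals I \<theta>)) * max 0 (h i (vals I \<theta> i) + h j (vals I \<theta> j)))"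
proof -
  note m = marketD[OF I]
  have ij: "i \<in> agents I" "j \<in> agents I" "j \<in> agents I - {i}" "i \<noteq> j" "i \<in> buyers I" "j \<notin> buyers I"
    using e m by (auto simp: agents_def)
  define rest where "rest = Pi_pmf (agents I - {i} - {j}) 0 (type_dist I)"
  have fin_rest: "finite (set_pmf rest)" unfolding rest_def by (rule finite_set_Pi_pmf) (use m in auto)
  define F where "F = value_dist I i"
  define G where "G = value_dist I j"
  have fin: "finite (set_pmf F)" "finite (set_pmf G)"
    using m(9) ij by (auto simp: F_def G_def value_dist_def)
  define zz where "zz \<theta> v b = vals I (\<theta>(j := val I j b, i := val I i v))" for \<theta> v b
  have zz: "zz \<theta> v b i = v" "zz \<theta> v b j = b" "a \<noteq> i \<Longrightarrow> a \<noteq> j \<Longrightarrow> zz \<theta> v b a = vals I \<theta> a" for \<theta> v b a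
    using ij by (auto simp: zz_def vals_def)
  have split: "measure_pmf.expectation (prior I) (\<lambda>\<theta>. \<phi> (vals I \<theta>)) =
     measure_pmf.expectation rest (\<lambda>\<theta>. \<Sum>v\<in>set_pmf F. pmf F v * (\<Sum>b\<in>set_pmf G. pmf G b * \<phi> (zz \<theta> v b)))"
    for \<phi> :: "('a \<Rightarrow> real) \<Rightarrow> real"
  proof -
    have inner: "measure_pmf.expectation (prior_others I i) \<psi> = (\<Sum>s\<in>set_pmf (type_dist I j). pmf (type_dist I j) s *
       measure_pmf.expectation rest (\<lambda>\<theta>. \<psi> (\<theta>(j := s))))" for \<psi> :: "('a \<Rightarrow> real) \<Rightarrow> real"
      unfolding prior_others_def rest_def by (rule expectation_Pi_pmf_split) (use m ij in auto)
    have "measure_pmf.expectation (prior I) (\<lambda>\<theta>. \<phi> (vals I \<theta>)) =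
      (\<Sum>t\<in>set_pmf (type_dist I i). pmf (type_dist I i) t * (\<Sum>s\<in>set_pmf (type_dist I j). pmf (type_dist I j) s *
       measure_pmf.expectation rest (\<lambda>\<theta>. \<phi> (zz \<theta> (val I i t) (val I j s)))))"
      unfolding prior_split[OF I ij(1)] inner by (simp add: zz_def)
    also have "\<dots> = (\<Sum>v\<in>set_pmf F. pmf F v * (\<Sum>b\<in>set_pmf G. pmf G b * measure_pmf.expectation rest (\<lambda>\<theta>. \<phi> (zz \<theta> v b))))"
      unfolding F_def G_def sum_value_dist ..
    also have "\<dots> = measure_pmf.expectation rest (\<lambda>\<theta>. \<Sum>v\<in>set_pmf F. pmf F v * (\<Sum>b\<in>set_pmf G. pmf G b * \<phi> (zz \<theta> v b)))"
      by (simp add: Bochner_Integration.integral_sum integrable_measure_pmf_finite[OF fin_rest])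
    finally show ?thesis .
  qed
  have restrict: "(\<Sum>b\<in>set_pmf G. pmf G b * (of_bool (P b) * k b)) = (\<Sum>b\<in>{b\<in>set_pmf G. P b}. pmf G b * k b)"
    for P and k :: "real \<Rightarrow> real"
    using fin by (intro sum.mono_neutral_cong_right) auto
  have "\<beta> * measure_pmf.expectation (prior I) (\<lambda>\<theta>. of_bool ((i, j) \<in> best (vals I \<theta>)) * (vals I \<theta> i + vals I \<theta> j)) =
    measure_pmf.expectation rest (\<lambda>\<theta>. \<beta> * (\<Sum>v\<in>set_pmf F. pmf F v *
       (\<Sum>b\<in>{b\<in>set_pmf G. (i, j) \<in> best (zz \<theta> v b)}. pmf G b * (v + b))))"
    unfolding split[of "\<lambda>z. of_bool ((i, j) \<in> best z) * (z i + z j)"] zz restrict by simp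
  also have "\<dots> \<le> measure_pmf.expectation rest (\<lambda>\<theta>. \<Sum>v\<in>set_pmf F. pmf F v *
       (\<Sum>b\<in>{b\<in>set_pmf G. (i, j) \<in> best (zz \<theta> v b)}. pmf G b * max 0 (h i v + h j b)))"
  proof (rule integral_mono[OF integrable_measure_pmf_finite[OF fin_rest] integrable_measure_pmf_finite[OF fin_rest]])
    fix \<theta>
    show "\<beta> * (\<Sum>v\<in>set_pmf F. pmf F v * (\<Sum>b\<in>{b\<in>set_pmf G. (i, j) \<in> best (zz \<theta> v b)}. pmf G b * (v + b)))
      \<le> (\<Sum>v\<in>set_pmf F. pmf F v * (\<Sum>b\<in>{b\<in>set_pmf G. (i, j) \<in> best (zz \<theta> v b)}. pmf G b * max 0 (h i v + h j b)))"
    proof (rule edge_inequality[OF fin \<alpha> \<beta> _ _ att])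
      show "ironed \<alpha> (pmf F) (set_pmf F) (h i)" "ironed \<alpha> (pmf G) (set_pmf G) (h j)"
        using h ij by (simp_all add: F_def G_def)
      show "0 \<le> v + b" if "(i, j) \<in> best (zz \<theta> v b)" for v b
        using nonneg[OF that] by (simp add: zz)
      show "(i, j) \<in> best (zz \<theta> v' b')" if "(i, j) \<in> best (zz \<theta> v b)" "v \<le> v'" "b \<le> b'" for v b v' b'
        by (rule mono[OF _ _ _ that(1)]) (use that zz in auto)
    qed
  qed
  also have "\<dots> = measure_pmf.expectation (prior I) (\<lambda>\<theta>. of_bool ((i, j) \<in> best (vals I \<theta>)) * max 0 (h i (vals I \<theta> i) + h j (vals I \<theta> j)))"
    unfolding split[of "\<lambda>z. of_bool ((i, j) \<in> best z) * max 0 (h i (z i) + h j (z j))"] zz restrict ..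
  finally show ?thesis .
qed

theorem theorem1p1:
  fixes \<alpha> \<beta> :: real
  assumes "\<alpha> \<ge> 0" and "\<beta> \<ge> 0"
    and "\<forall>I :: nat market. bilateral_trade I \<longrightarrow> V \<alpha> I \<ge> ereal (\<beta> * FB I)"
  shows "\<forall>I :: 'a market. matching_market I \<longrightarrow> V \<alpha> I \<ge> ereal (\<beta> * FB I)"
proof (intro allI impI)
  fix I :: "'a market" assume I: "matching_market I"
  note m = marketD[OF I]
  have "\<exists>h. ironed \<alpha> (pmf (value_dist I a)) (set_pmf (value_dist I a)) h" if "a \<in> agents I" for a
    using m(9)[OF that] by (intro ironed_exists) (auto simp: value_dist_def pmf_positive_iff)
  then have "\<forall>a\<in>agents I. \<exists>h. ironed \<alpha> (pmf (value_dist I a)) (set_pmf (value_dist I a)) h" by blast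
  from bchoice[OF this] obtain h
    where h: "\<And>a. a \<in> agents I \<Longrightarrow> ironed \<alpha> (pmf (value_dist I a)) (set_pmf (value_dist I a)) (h a)"
    by blast
  \<comment> \<open>One selection serves twice: at the true values it is a first-best matching, at
    the ironed values it is the allocation of the mechanism.\<close>
  obtain best where C: "consistent_argmax (weight I) (feasible I) best"
    using consistent_argmax_exists[OF m(11) m(6)] by blast
  note best = consistent_argmaxD[OF C]
  have sub: "N \<subseteq> edges I" if "N \<in> feasible I" for N using m(7)[OF that] by (simp add: matching_def)
  have indicator: "(\<Sum>(i, j)\<in>N. k i j) = (\<Sum>(i, j)\<in>edges I. of_bool ((i, j) \<in> N) * (k i j :: real))" if "N \<in> feasible I" for N k
    by (rule sum.mono_neutral_cong_left) (use sub[OF that] m(10) in auto)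
  have nonneg: "0 \<le> z i + z j" if ij: "(i, j) \<in> best z" for z i j
  proof -
    \<comment> \<open>Downward closure: dropping a single edge from a maximizer stays feasible and
      cannot increase the weight.\<close>
    have f: "best z - {(i, j)} \<in> feasible I" by (rule m(8)[OF best(1)[of z]]) (rule Diff_subset)
    have "finite (best z)" by (rule finite_subset[OF sub[OF best(1)] m(10)])
    from sum.remove[OF this ij, of "\<lambda>(i, j). z i + z j"]
    have "weight I z (best z) = weight I z (best z - {(i, j)}) + (z i + z j)"
      unfolding weight_eq[OF I sub[OF best(1)]] weight_eq[OF I sub[OF f]] by simp
    then show ?thesis using best(2)[OF f, of z] by simp
  qed
  define hats where "hats \<theta> a = h a (vals I \<theta> a)" for \<theta> a
  note integrable = integrable_measure_pmf_finite[OF finite_prior(1)[OF I]]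
  have "FB I = measure_pmf.expectation (prior I) (\<lambda>\<theta>. weight I (vals I \<theta>) (best (vals I \<theta>)))"
    unfolding FB_def
  proof (intro Bochner_Integration.integral_cong refl)
    fix \<theta>
    have eq: "(\<Sum>(i, j)\<in>N. \<theta> i - \<theta> j) = weight I (vals I \<theta>) N" if "N \<in> feasible I" for N
      unfolding weight_eq[OF I sub[OF that]]
    proof (intro sum.cong refl)
      fix e assume "e \<in> N"
      then have "e \<in> buyers I \<times> sellers I" using sub[OF that] m(5) by blast
      then have "fst e \<in> buyers I" "snd e \<notin> buyers I" using m(4) by (auto simp: mem_Times_iff)
      then show "(case e of (i, j) \<Rightarrow> \<theta> i - \<theta> j) = (case e of (i, j) \<Rightarrow> vals I \<theta> i + vals I \<theta> j)"
        by (simp add: vals_def val_def case_prod_unfold)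
    qed
    have "(\<lambda>N. \<Sum>(i, j)\<in>N. \<theta> i - \<theta> j) ` feasible I = weight I (vals I \<theta>) ` feasible I"
      using eq by (intro image_cong) auto
    then show "Max ((\<lambda>N. \<Sum>(i, j)\<in>N. \<theta> i - \<theta> j) ` feasible I) = weight I (vals I \<theta>) (best (vals I \<theta>))"
      using best m(11) by (auto intro!: Max_eqI)
  qed
  also have "\<dots> = measure_pmf.expectation (prior I) (\<lambda>\<theta>. \<Sum>(i, j)\<in>edges I.
      of_bool ((i, j) \<in> best (vals I \<theta>)) * (vals I \<theta> i + vals I \<theta> j))"
    unfolding weight_eq[OF I sub[OF best(1)]] indicator[OF best(1)] ..
  also have "\<dots> = (\<Sum>e\<in>edges I. measure_pmf.expectation (prior I)
      (\<lambda>\<theta>. of_bool ((fst e, snd e) \<in> best (vals I \<theta>)) * (vals I \<theta> (fst e) + vals I \<theta> (snd e))))"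
    unfolding case_prod_unfold by (rule Bochner_Integration.integral_sum) (rule integrable)
  finally have "\<beta> * FB I = (\<Sum>e\<in>edges I. \<beta> * measure_pmf.expectation (prior I)
      (\<lambda>\<theta>. of_bool ((fst e, snd e) \<in> best (vals I \<theta>)) * (vals I \<theta> (fst e) + vals I \<theta> (snd e))))"
    by (simp add: sum_distrib_left)
  also have "\<dots> \<le> (\<Sum>e\<in>edges I. measure_pmf.expectation (prior I)
      (\<lambda>\<theta>. of_bool ((fst e, snd e) \<in> best (vals I \<theta>)) * max 0 (h (fst e) (vals I \<theta> (fst e)) + h (snd e) (vals I \<theta> (snd e)))))"
  proof (rule sum_mono)
    fix e assume e: "e \<in> edges I"
    show "\<beta> * measure_pmf.expectation (prior I)
      (\<lambda>\<theta>. of_bool ((fst e, snd e) \<in> best (vals I \<theta>)) * (vals I \<theta> (fst e) + vals I \<theta> (snd e)))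
      \<le> measure_pmf.expectation (prior I)
      (\<lambda>\<theta>. of_bool ((fst e, snd e) \<in> best (vals I \<theta>)) * max 0 (h (fst e) (vals I \<theta> (fst e)) + h (snd e) (vals I \<theta> (snd e))))"
    proof (rule edge_expectation[OF I _ assms(1,2) _ h])
      show e': "(fst e, snd e) \<in> edges I" using e by simp
      show "attainable \<alpha> \<beta> F G" if "finite (set_pmf F)" "finite (set_pmf G)" for F G
        by (rule bilateral_attainable[OF assms(3) that])
      show "0 \<le> z (fst e) + z (snd e)" if "(fst e, snd e) \<in> best z" for z by (rule nonneg[OF that])
      show "(fst e, snd e) \<in> best z'" if "z (fst e) \<le> z' (fst e)" "z (snd e) \<le> z' (snd e)"
        "\<And>b. b \<noteq> fst e \<Longrightarrow> b \<noteq> snd e \<Longrightarrow> z' b = z b" "(fst e, snd e) \<in> best z" for z z'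
        by (rule edge_monotone[OF I e' C that])
    qed
  qed
  also have "\<dots> = measure_pmf.expectation (prior I) (\<lambda>\<theta>. \<Sum>(i, j)\<in>edges I.
      of_bool ((i, j) \<in> best (vals I \<theta>)) * max 0 (hats \<theta> i + hats \<theta> j))"
    unfolding case_prod_unfold hats_def by (rule Bochner_Integration.integral_sum[symmetric]) (rule integrable)
  also have "\<dots> = measure_pmf.expectation (prior I) (\<lambda>\<theta>. \<Sum>(i, j)\<in>best (vals I \<theta>). max 0 (hats \<theta> i + hats \<theta> j))"
    unfolding indicator[OF best(1)] ..
  also have "\<dots> \<le> measure_pmf.expectation (prior I) (\<lambda>\<theta>. weight I (hats \<theta>) (best (hats \<theta>)))"
  proof (rule integral_mono[OF integrable integrable])
    fix \<theta>
    define N where "N = best (vals I \<theta>)"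
    \<comment> \<open>On this subset the positive parts are the ironed sums themselves; downward
      closure makes it a competitor of the matching that is optimal for the ironed values.\<close>
    define N' where "N' = {(i, j) \<in> N. 0 \<le> hats \<theta> i + hats \<theta> j}"
    have f: "N' \<in> feasible I" by (rule m(8)[OF best(1)[of "vals I \<theta>"]]) (auto simp: N'_def N_def)
    have "finite N" unfolding N_def by (rule finite_subset[OF sub[OF best(1)] m(10)])
    then have "(\<Sum>(i, j)\<in>N. max 0 (hats \<theta> i + hats \<theta> j)) = weight I (hats \<theta>) N'"
      unfolding weight_eq[OF I sub[OF f]] by (intro sum.mono_neutral_cong_right) (auto simp: N'_def)
    also have "\<dots> \<le> weight I (hats \<theta>) (best (hats \<theta>))" by (rule best(2)[OF f])
    finally show "(\<Sum>(i, j)\<in>best (vals I \<theta>). max 0 (hats \<theta> i + hats \<theta> j)) \<le> weight I (hats \<theta>) (best (hats \<theta>))"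
      by (simp add: N_def)
  qed
  finally have "ereal (\<beta> * FB I) \<le> ereal (measure_pmf.expectation (prior I) (\<lambda>\<theta>. weight I (hats \<theta>) (best (hats \<theta>))))"
    by simp
  also have "\<dots> \<le> V \<alpha> I"
    unfolding hats_def by (rule V_ge_ironed[OF I h C])
  finally show "V \<alpha> I \<ge> ereal (\<beta> * FB I)" .
qed

end
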